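(* Assume Hypothesis (H) (see context). Then there exist constants $C_1,C_2>0$, depending only on $\mathfrak e$ and $\gamma$, such that for every $\mu>0$ $$ \mathcal N^+(\hat{\bf h}_\mu,\mathfrak e_{\max})\le 1+C_1\,\mu\sum_{x\in\mathbb Z^d}|x|^{2-d+\gamma}|\hat v(x)|, \qquad \mathcal N^-(\hat{\bf h}_\mu,\mathfrak e_{\min})\le 1+C_2\,\mu\sum_{x\in\mathbb Z^d}|x|^{2-d+\gamma}|\hat v(x)|. $$ In particular, for every $\mu>0$ the number of eigenvalues of $\hat{\bf h}_\mu$ outside $[\mathfrak e_{\min},\mathfrak e_{\max}]$ is finite.
   Context: Let $d\in\{1,2\}$ and $\mathbb T^d=(-\pi,\pi]^d$ with normalized Haar measure $dp$ ($\int_{\mathbb T^d}dp=1$). Let $\hat{\mathfrak e}\in\ell^1(\mathbb Z^d)$ with $\overline{\hat{\mathfrak e}(-x)}=\hat{\mathfrak e}(x)$, and $\hat v:\mathbb Z^d\to\mathbb R$. On $\ell^2(\mathbb Z^d)$ define $(\hat{\bf h}_0\hat f)(x)=\sum_{y\in\mathbb Z^d}\hat{\mathfrak e}(y)\hat f(x+y)$, $(\hat{\bf v}\hat f)(x)=\hat v(x)\hat f(x)$, and $\hat{\bf h}_\mu=\hat{\bf h}_0+\mu\hat{\bf v}$, $\mu\ge0$. Let $\mathcal F:\ell^2(\mathbb Z^d)\to L^2(\mathbb T^d)$, $(\mathcal F\hat f)(p)=\sum_x\hat f(x)e^{ix\cdot p}$, with inverse $(\mathcal F^*f)(x)=\int_{\mathbb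 T^d}f(p)e^{-ix\cdot p}dp$. Set $\mathfrak e:=\mathcal F\hat{\mathfrak e}$ (a continuous real function on $\mathbb T^d$), $\mathfrak e_{\min}=\min\mathfrak e$, $\mathfrak e_{\max}=\max\mathfrak e$. Hypothesis (H): (a) $\mathfrak e$ has a unique minimum point $p_0$ and a unique maximum point $p^0$, $\mathfrak e$ is $C^2$ in a neighbourhood of $p_0$ and of $p^0$, and both critical points are non-degenerate (invertible Hessian); (b) there exists $\gamma\in(0,1)$ with $0<\sum_{x\in\mathbb Z^d}|x|^{2-d+\gamma}|\hat v(x)|<\infty$. Under (H), $\hat v\in\ell^1$ and $\sigma_{ess}(\hat{\bf h}_\mu)=[\mathfrak e_{\min},\mathfrak e_{\max}]$. For a self-adjoint operator $A$ and $\lambda\in\mathbb R$, $\mathcal N^+(A,\lambda)$ (resp. $\mathcal N^-(A,\lambda)$) denotes the number of eigenvalues of $A$ in $(\lambda,\infty)$ (resp. $(-\infty,\lambda)$), counted with multiplicity. *)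

theory Defs
  imports "HOL-Analysis.Analysis" "HOL-Library.Extended_Real"
begin

text \<open>Lattice points of Z^d are modelled as int^'n with CARD('n) = d;
  quasi-momenta as real^'n.\<close>

definition lat_to_real :: "int^'n \<Rightarrow> real^'n" where
  "lat_to_real x = (\<chi> i. real_of_int (x $ i))"

definition lat_norm :: "int^'n \<Rightarrow> real" where
  "lat_norm x = norm (lat_to_real x)"

definition torus :: "(real^'n) set" where
  "torus = {p. \<forall>i. - pi < p $ i \<and> p $ i \<le> pi}"

text \<open>The dispersion relation e = F e_hat, e(p) = sum_x e_hat(x) exp(i x.p).
  It is real-valued under the symmetry hypothesis; we take its real part.\<close>
definition disp :: "(int^'n \<Rightarrow> complex) \<Rightarrow> real^'n \<Rightarrow> real" where
  "disp eh p = Re (\<Sum>\<^sub>\<infinity>x. eh x * cis (lat_to_real x \<bullet> p))"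

definition l2 :: "(int^'n \<Rightarrow> complex) \<Rightarrow> bool" where
  "l2 f \<longleftrightarrow> (\<lambda>x. (cmod (f x))\<^sup>2) summable_on UNIV"

definition hop :: "(int^'n \<Rightarrow> complex) \<Rightarrow> (int^'n \<Rightarrow> real) \<Rightarrow> real
                   \<Rightarrow> (int^'n \<Rightarrow> complex) \<Rightarrow> int^'n \<Rightarrow> complex" where
  "hop eh v \<mu> f x = (\<Sum>\<^sub>\<infinity>y. eh y * f (x + y)) + complex_of_real (\<mu> * v x) * f x"

definition is_eigvec :: "(int^'n \<Rightarrow> complex) \<Rightarrow> (int^'n \<Rightarrow> real) \<Rightarrow> real
                   \<Rightarrow> real \<Rightarrow> (int^'n \<Rightarrow> complex) \<Rightarrow> bool" where
  "is_eigvec eh v \<mu> E f \<longleftrightarrow> l2 f \<and> f \<noteq> (\<lambda>_. 0) \<and>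
      (\<forall>x. hop eh v \<mu> f x = complex_of_real E * f x)"

definition lin_indep :: "(int^'n \<Rightarrow> complex) set \<Rightarrow> bool" where
  "lin_indep S \<longleftrightarrow> (\<forall>c. (\<forall>x. (\<Sum>f\<in>S. c f * f x) = 0) \<longrightarrow> (\<forall>f\<in>S. c f = 0))"

text \<open>Number of eigenvalues (with multiplicity) in a set I: the dimension of the
  span of all eigenvectors with eigenvalue in I, i.e. the supremum of the sizes
  of finite linearly independent families of such eigenvectors.\<close>
definition eig_count :: "(int^'n \<Rightarrow> complex) \<Rightarrow> (int^'n \<Rightarrow> real) \<Rightarrow> real
                   \<Rightarrow> real set \<Rightarrow> enat" where
  "eig_count eh v \<mu> I = (SUP S\<in>{S. finite S \<and> lin_indep S \<and>
        (\<forall>f\<in>S. \<exists>E\<in>I. is_eigvec eh v \<mu> E f)}. enat (card S))"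

definition Nplus where "Nplus eh v \<mu> t = eig_count eh v \<mu> {t<..}"
definition Nminus where "Nminus eh v \<mu> t = eig_count eh v \<mu> {..<t}"

definition C2_nondeg_at :: "(real^'n \<Rightarrow> real) \<Rightarrow> real^'n \<Rightarrow> bool" where
  "C2_nondeg_at f p0 \<longleftrightarrow> (\<exists>U g H. open U \<and> p0 \<in> U \<and>
     (\<forall>p\<in>U. (f has_derivative (\<lambda>h. g p \<bullet> h)) (at p)) \<and>
     (\<forall>p\<in>U. (g has_derivative (\<lambda>h. H p *v h)) (at p)) \<and>
     continuous_on U H \<and> invertible (H p0))"

end

theory Submission
  imports Defs
begin

text \<open>
  Let \<open>B f = emax * \<parallel>f\<parallel>\<^sup>2 - \<langle>h0 f, f\<rangle>\<close>; in Fourier space this is the integral of \<open>|Ff|\<^sup>2\<close> against the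
  weight \<open>emax - e\<close>, which is at least \<open>c * |p - p1|\<^sup>2\<close>. If \<open>f 0 = 0\<close> then, up to a phase, \<open>f x\<close> is the
  integral of \<open>Ff\<close> against \<open>exp (i x \<bullet> (p - p1)) - 1\<close>. Put \<open>s = 2 - d + \<gamma>\<close>. Since
  \<open>|exp (i t) - 1|\<^sup>2 \<le> 4 * |t| powr s\<close> and \<open>|q| powr (s - 2) = |q| powr (\<gamma> - d)\<close> is integrable at the
  origin, the Cauchy-Schwarz inequality gives \<open>|f x|\<^sup>2 \<le> C * |x| powr s * B f\<close>.

  On the span of the eigenvectors with eigenvalue above \<open>emax\<close> one has \<open>B f \<le> \<mu> * \<Sum> |v| |f|\<^sup>2\<close>.
  Requiring \<open>f 0 = 0\<close> costs one dimension, and a trace over a \<open>B\<close>-orthonormal basis of what remains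
  bounds its dimension by \<open>C * \<mu> * \<Sum> |x| powr s * |v x|\<close>. The lower edge follows by changing the signs
  of \<open>e\<close> and \<open>v\<close>.
\<close>

text \<open>The condition \<open>f 0 = 0\<close> answers an obstacle of low dimension. For
  \<open>d \<le> 2\<close> the inverse weight \<open>|q| powr (- 2)\<close> is not integrable at the
  maximum, so the energy alone cannot control \<open>f x\<close>. Subtracting the vanishing
  coefficient at the origin inserts a factor that is small for small \<open>q\<close>; the price is
  the growth \<open>|x| powr s\<close> and the \<open>1\<close> in the final estimate. As
  \<open>0 powr s = 0\<close>, the value \<open>v 0\<close> does not enter the sum either.

  Fourier analysis is done only for trigonometric polynomials. Restricting \<open>f\<close> to a
  finite set preserves \<open>f 0 = 0\<close>, and the constant in the pointwise bound does not
  depend on that set, so the bound passes to the limit over finite sets. The spectral theorem is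
  avoided in the same spirit: a finite independent family of eigenvectors lies in a finite sum of
  mutually orthogonal eigenspaces, and a bound on the size of every such family bounds the supremum
  that defines the count.\<close>

section \<open>The dispersion relation near its maximum\<close>

text \<open>An ascent step along the gradient \<open>g\<close> shows \<open>|g q|\<^sup>2 \<le> 4 L (f p - f q)\<close>, while \<open>|g q|\<close> is bounded
  below by a multiple of \<open>|q - p|\<close> since the Hessian is invertible.\<close>

lemma nondegenerate_max_quadratic_bound:
  fixes f :: "real^'n \<Rightarrow> real"
  assumes C2: "C2_nondeg_at f p" and max: "\<And>q. f q \<le> f p"
  obtains c r where "c > 0" "r > 0" "\<And>q. q \<in> ball p r \<Longrightarrow> c * (norm (q - p))\<^sup>2 \<le> f p - f q"
proof -
  obtain U g H where U: "open U" "p \<in> U"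
    and f': "\<And>q. q \<in> U \<Longrightarrow> (f has_derivative (\<lambda>h. g q \<bullet> h)) (at q)"
    and g': "\<And>q. q \<in> U \<Longrightarrow> (g has_derivative (\<lambda>h. H q *v h)) (at q)"
    and H: "continuous_on U H" "invertible (H p)"
    using C2 unfolding C2_nondeg_at_def by blast
  obtain R where R: "R > 0" "cball p R \<subseteq> U"
    using U open_contains_cball by blast
  have "compact (H ` cball p R)"
    by (intro compact_continuous_image continuous_on_subset[OF H(1)] R compact_cball)
  then obtain K where K: "\<And>q. q \<in> cball p R \<Longrightarrow> norm (H q) \<le> K"
    by (metis bounded_iff compact_imp_bounded imageI)
  \<comment> \<open>Entries bounded by \<open>K\<close> bound the operator norm by \<open>K\<close>
    times the square of \<open>CARD('n)\<close>; the added 1 makes \<open>L\<close> safe to divide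
    by.\<close>
  define L where "L = real CARD('n) * real CARD('n) * K + 1"
  have onormH: "onorm ((*v) (H q)) \<le> L" if "q \<in> cball p R" for q
  proof -
    have "\<bar>H q $ i $ j\<bar> \<le> K" for i j
      by (metis K Finite_Cartesian_Product.norm_nth_le order_trans real_norm_def that)
    from onorm_le_matrix_component[of "H q", OF this] show ?thesis
      by (simp add: L_def)
  qed
  have lip: "norm (g x - g y) \<le> L * norm (x - y)" if "x \<in> cball p R" "y \<in> cball p R" for x y
    using R that onormH
    by (intro differentiable_bound[of "cball p R" g "\<lambda>q. (*v) (H q)"])
       (auto intro!: has_derivative_at_withinI[OF g'])
  have "0 \<le> K"
    using order_trans[OF norm_ge_zero K[of p]] R(1) by simp
  then have "L \<ge> 1"
    by (simp add: L_def)
  have "(\<lambda>h. g p \<bullet> h) = (\<lambda>_. 0)"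
    using differential_zero_maxmin[of p U f, OF U(2,1) f'[OF U(2)]] max by blast
  then have "g p \<bullet> g p = 0"
    by metis
  then have gp: "g p = 0"
    by simp
  obtain B where B: "B ** H p = mat 1"
    using H(2) unfolding invertible_def by blast
  \<comment> \<open>Since \<open>|h| = |B (H p h)|\<close>, the norm of the left inverse bounds
    \<open>H p\<close> from below.\<close>
  define b where "b = onorm ((*v) B) + 1"
  have "b \<ge> 1"
    using onorm_pos_le[OF matrix_vector_mul_bounded_linear[of B]] by (simp add: b_def)
  have lower: "norm h \<le> b * norm (H p *v h)" for h
  proof -
    have "norm h = norm (B *v (H p *v h))"
      by (simp add: matrix_vector_mul_assoc B)
    also have "\<dots> \<le> onorm ((*v) B) * norm (H p *v h)"
      by (rule onorm) simp
    also have "\<dots> \<le> b * norm (H p *v h)"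
      by (intro mult_right_mono) (auto simp: b_def)
    finally show ?thesis .
  qed
  \<comment> \<open>With this accuracy in the linearisation of \<open>g\<close> at \<open>p\<close>,
    the error in \<open>glower\<close> costs at most half of \<open>|q - p|\<close> and is absorbed
    on the left.\<close>
  have "1 / (2 * b) > 0"
    using \<open>b \<ge> 1\<close> by simp
  then obtain d where d: "d > 0"
    "\<And>y. norm (y - p) < d \<Longrightarrow> norm (g y - g p - H p *v (y - p)) \<le> 1 / (2 * b) * norm (y - p)"
    using g'[OF U(2)] unfolding has_derivative_at_alt by blast
  have glower: "norm (q - p) \<le> 2 * b * norm (g q)" if "norm (q - p) < d" for q
  proof -
    have "norm (q - p) \<le> b * norm (H p *v (q - p))"
      by (rule lower)
    also have "norm (H p *v (q - p)) \<le> norm (g q) + norm (g q - H p *v (q - p))"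
      using norm_triangle_ineq4[of "g q" "g q - H p *v (q - p)"] by simp
    also have "\<dots> \<le> norm (g q) + 1 / (2 * b) * norm (q - p)"
      using d(2)[OF that] gp by simp
    finally have "norm (q - p) \<le> b * (norm (g q) + 1 / (2 * b) * norm (q - p))"
      using \<open>b \<ge> 1\<close> by simp
    then show ?thesis
      using \<open>b \<ge> 1\<close> by (simp add: field_simps)
  qed
  \<comment> \<open>\<open>R / 2\<close> leaves room for the ascent step, whose length is at most
    \<open>|q - p| / 2\<close>. The constant \<open>c\<close> combines
    \<open>|q - p| \<le> 2 * b * |w|\<close> with the gain \<open>|w|^2 / (4 * L)\<close>.\<close>
  define r where "r = min d (R / 2)"
  define c where "c = 1 / (16 * b\<^sup>2 * L)"
  have "c * (norm (q - p))\<^sup>2 \<le> f p - f q" if "q \<in> ball p r" for q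
  proof -
    define w where "w = g q"
    \<comment> \<open>As \<open>L * t = 1 / 2\<close>, the gradient changes along the step by at
      most \<open>|w| / 2\<close>, so at least half of the first-order gain survives.\<close>
    define t where "t = 1 / (2 * L)"
    have q: "norm (q - p) < d" "norm (q - p) < R / 2"
      using that by (auto simp: r_def dist_norm norm_minus_commute)
    have w_le: "norm w \<le> L * norm (q - p)"
      using lip[of q p] q R gp by (simp add: w_def dist_norm norm_minus_commute)
    have t: "t > 0" "L * t = 1 / 2"
      using \<open>L \<ge> 1\<close> by (auto simp: t_def)
    have inball: "q + s *\<^sub>R w \<in> cball p R" if "0 \<le> s" "s \<le> t" for s
    proof -
      have "norm (s *\<^sub>R w) \<le> t * (L * norm (q - p))"
        using that w_le t by (simp add: mult_mono)
      also have "\<dots> = norm (q - p) / 2"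
        using t by (simp add: mult.assoc[symmetric] mult.commute)
      finally have "norm (q + s *\<^sub>R w - p) \<le> norm (q - p) + norm (q - p) / 2"
        using norm_triangle_ineq[of "q - p" "s *\<^sub>R w"] by (simp add: algebra_simps)
      then show ?thesis
        using q R by (simp add: dist_norm norm_minus_commute)
    qed
    have "((\<lambda>s. f (q + s *\<^sub>R w)) has_derivative (\<lambda>u. g (q + s *\<^sub>R w) \<bullet> (u *\<^sub>R w))) (at s within {0..t})"
      if "0 \<le> s" "s \<le> t" for s
    proof -
      have "q + s *\<^sub>R w \<in> U"
        using inball that R by blast
      then have "(f has_derivative (\<lambda>h. g (q + s *\<^sub>R w) \<bullet> h)) (at (q + s *\<^sub>R w))"
        using f' by simp
      moreover have "((\<lambda>s. q + s *\<^sub>R w) has_derivative (\<lambda>u. u *\<^sub>R w)) (at s within {0..t})"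
        by (auto intro!: derivative_eq_intros)
      ultimately have "((\<lambda>s. f (q + s *\<^sub>R w)) has_derivative (\<lambda>u. g (q + s *\<^sub>R w) \<bullet> (u *\<^sub>R w))) (at s within {0..t})"
        using has_derivative_compose by fastforce
      then show ?thesis
        .
    qed
    from mvt_simple[OF t(1), of "\<lambda>s. f (q + s *\<^sub>R w)", OF this]
    obtain s where s: "0 < s" "s < t" "f (q + t *\<^sub>R w) - f q = g (q + s *\<^sub>R w) \<bullet> (t *\<^sub>R w)"
      by auto
    have "norm (g (q + s *\<^sub>R w) - w) \<le> L * (s * norm w)"
      using lip[OF inball[of s] inball[of 0]] s t by (simp add: w_def)
    also have "\<dots> \<le> L * (t * norm w)"
      using s \<open>L \<ge> 1\<close> by (intro mult_left_mono mult_right_mono) auto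
    also have "\<dots> = norm w / 2"
      using t by (simp add: mult.assoc[symmetric])
    finally have "norm (g (q + s *\<^sub>R w) - w) * norm w \<le> norm w / 2 * norm w"
      by (rule mult_right_mono) simp
    then have "(g (q + s *\<^sub>R w) - w) \<bullet> w \<ge> - (norm w)\<^sup>2 / 2"
      using Cauchy_Schwarz_ineq2[of "g (q + s *\<^sub>R w) - w" w] by (simp add: power2_eq_square)
    then have "g (q + s *\<^sub>R w) \<bullet> w \<ge> (norm w)\<^sup>2 / 2"
      by (simp add: inner_diff_left power2_norm_eq_inner)
    then have "t * ((norm w)\<^sup>2 / 2) \<le> t * (g (q + s *\<^sub>R w) \<bullet> w)"
      using t by (intro mult_left_mono) auto
    also have "\<dots> = f (q + t *\<^sub>R w) - f q"
      using s by simp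
    also have "\<dots> \<le> f p - f q"
      using max[of "q + t *\<^sub>R w"] by simp
    finally have "(norm w)\<^sup>2 / (4 * L) \<le> f p - f q"
      by (simp add: t_def)
    moreover have "(norm (q - p))\<^sup>2 \<le> (2 * b * norm w)\<^sup>2"
      using glower[OF q(1)] by (intro power_mono) (auto simp: w_def)
    then have "c * (norm (q - p))\<^sup>2 \<le> c * (2 * b * norm w)\<^sup>2"
      using \<open>L \<ge> 1\<close> by (intro mult_left_mono) (auto simp: c_def)
    moreover have "c * (2 * b * norm w)\<^sup>2 = (norm w)\<^sup>2 / (4 * L)"
      using \<open>L \<ge> 1\<close> \<open>b \<ge> 1\<close> by (simp add: c_def power_mult_distrib field_simps)
    ultimately show ?thesis
      by linarith
  qed
  moreover have "c > 0"
    using \<open>L \<ge> 1\<close> \<open>b \<ge> 1\<close> by (simp add: c_def)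
  moreover have "r > 0"
    using d R by (simp add: r_def)
  ultimately show ?thesis
    using that[of c r] by blast
qed

section \<open>Fourier series of the dispersion relation\<close>

definition disp_c :: "(int^'n \<Rightarrow> complex) \<Rightarrow> real^'n \<Rightarrow> complex" where
  "disp_c eh p = (\<Sum>\<^sub>\<infinity>x. eh x * cis (lat_to_real x \<bullet> p))"

lemma uniform_limit_disp:
  fixes eh :: "int^'n \<Rightarrow> complex"
  assumes "(\<lambda>x. norm (eh x)) summable_on UNIV"
  shows "uniform_limit S (\<lambda>X p. \<Sum>x\<in>X. eh x * cis (lat_to_real x \<bullet> p)) (disp_c eh)
    (finite_subsets_at_top UNIV)"
  unfolding disp_c_def
  by (rule Weierstrass_m_test_general[where M = "\<lambda>x. norm (eh x)"]) (auto simp: norm_mult assms)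

lemma continuous_on_disp_c:
  fixes eh :: "int^'n \<Rightarrow> complex"
  assumes "(\<lambda>x. norm (eh x)) summable_on UNIV"
  shows "continuous_on S (disp_c eh)"
  by (rule uniform_limit_theorem[OF _ uniform_limit_disp[OF assms]])
     (auto intro!: always_eventually continuous_intros)

text \<open>Conjugation followed by the reflection of \<open>x\<close> to \<open>- x\<close> fixes
  the series, so it is real. The complex series is kept because termwise Fourier integration applies
  to it directly.\<close>

lemma disp_c_eq_disp:
  fixes eh :: "int^'n \<Rightarrow> complex"
  assumes "\<And>x. cnj (eh (- x)) = eh x"
  shows "disp_c eh p = complex_of_real (disp eh p)"
proof -
  have "cnj (disp_c eh p) = (\<Sum>\<^sub>\<infinity>x. cnj (eh x) * cis (- (lat_to_real x \<bullet> p)))"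
    by (simp add: disp_c_def infsum_cnj[symmetric] cis_cnj)
  also have "\<dots> = (\<Sum>\<^sub>\<infinity>x. cnj (eh (- x)) * cis (lat_to_real x \<bullet> p))"
  proof (rule infsum_reindex_bij_witness[of UNIV uminus uminus])
    show "cnj (eh (- (- x))) * cis (lat_to_real (- x) \<bullet> p) = cnj (eh x) * cis (- (lat_to_real x \<bullet> p))" for x
      by (simp add: lat_to_real_def inner_vec_def sum_negf)
  qed auto
  also have "\<dots> = disp_c eh p"
    by (simp add: assms disp_c_def)
  finally have "Im (disp_c eh p) = 0"
    by (metis cnj.simps(2) equal_neg_zero)
  then show ?thesis
    by (simp add: complex_eq_iff disp_def disp_c_def)
qed

lemma continuous_on_disp:
  fixes eh :: "int^'n \<Rightarrow> complex"
  assumes "(\<lambda>x. norm (eh x)) summable_on UNIV"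
  shows "continuous_on S (disp eh)"
  using continuous_on_Re[OF continuous_on_disp_c[OF assms]] by (simp add: disp_def disp_c_def)

lemma disp_periodic:
  fixes eh :: "int^'n \<Rightarrow> complex"
  shows "disp eh (p + (2 * pi) *\<^sub>R lat_to_real k) = disp eh p"
proof -
  have "cis (lat_to_real x \<bullet> (p + (2 * pi) *\<^sub>R lat_to_real k)) = cis (lat_to_real x \<bullet> p)" for x :: "int^'n"
  proof -
    have "lat_to_real x \<bullet> lat_to_real k \<in> \<int>"
      by (auto simp: lat_to_real_def inner_vec_def intro!: Ints_sum)
    then show ?thesis
      by (simp add: inner_add_right cis_mult[symmetric] cis_multiple_2pi)
  qed
  then show ?thesis
    by (simp add: disp_def)
qed

lemma torus_representative:
  fixes p :: "real^'n"
  obtains k where "p + (2 * pi) *\<^sub>R lat_to_real k \<in> torus"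
proof
  \<comment> \<open>The floor fits the half-open \<open>torus\<close>: with
    \<open>a = (pi - p $ i) / (2 * pi)\<close>, the inequalities \<open>k \<le> a < k + 1\<close>
    rearrange to \<open>- pi < p $ i + 2 * pi * k \<le> pi\<close>.\<close>
  define k :: "int^'n" where "k = (\<chi> i. \<lfloor>(pi - p $ i) / (2 * pi)\<rfloor>)"
  have "- pi < p $ i + (2 * pi) * real_of_int (k $ i) \<and> p $ i + (2 * pi) * real_of_int (k $ i) \<le> pi" for i
  proof -
    have "real_of_int (k $ i) \<le> (pi - p $ i) / (2 * pi)" "(pi - p $ i) / (2 * pi) < real_of_int (k $ i) + 1"
      unfolding k_def by auto
    then show ?thesis
      using pi_gt_zero by (simp add: field_simps)
  qed
  then show "p + (2 * pi) *\<^sub>R lat_to_real k \<in> torus"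
    by (simp add: torus_def lat_to_real_def)
qed

text \<open>Closed, unlike \<open>torus\<close>, so that continuous functions are integrable on it
  and attain their extrema. Momenta are written \<open>p1 + q\<close> with \<open>q\<close> in this
  cube, which puts the maximum at the origin.\<close>

definition pi_cube :: "(real^'n) set" where
  "pi_cube = cbox (\<chi> i. - pi) (\<chi> i. pi)"

lemma mem_pi_cube: "q \<in> pi_cube \<longleftrightarrow> (\<forall>i. - pi \<le> q $ i \<and> q $ i \<le> pi)"
  by (simp add: pi_cube_def mem_box_cart)

text \<open>Near the origin this is non-degeneracy; on the rest of the cube compactness turns
  uniqueness of the maximum into a positive gap. Uniqueness applies because a point
  \<open>p1 + q\<close> equivalent to \<open>p1\<close> modulo the period has all
  \<open>q $ i\<close> in \<open>2 * pi\<close> times the integers, while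
  \<open>|q $ i| \<le> pi\<close>.\<close>

lemma disp_quadratic_bound:
  fixes eh :: "int^'n \<Rightarrow> complex"
  assumes l1: "(\<lambda>x. norm (eh x)) summable_on UNIV"
    and maxpt: "p1 \<in> torus" "\<And>p. p \<in> torus \<Longrightarrow> p \<noteq> p1 \<Longrightarrow> disp eh p < disp eh p1"
    and C2: "C2_nondeg_at (disp eh) p1"
  obtains c where "c > 0" "\<And>q. q \<in> pi_cube \<Longrightarrow> c * (norm q)\<^sup>2 \<le> disp eh p1 - disp eh (p1 + q)"
proof -
  have glob: "disp eh p \<le> disp eh p1" for p
    by (metis disp_periodic torus_representative maxpt(2) order.order_iff_strict)
  have strict: "disp eh (p1 + q) < disp eh p1" if q: "q \<in> pi_cube" "q \<noteq> 0" for q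
  proof -
    obtain k where k: "p1 + q + (2 * pi) *\<^sub>R lat_to_real k \<in> torus"
      using torus_representative by blast
    have "p1 + q + (2 * pi) *\<^sub>R lat_to_real k \<noteq> p1"
    proof
      assume eq: "p1 + q + (2 * pi) *\<^sub>R lat_to_real k = p1"
      have "q $ i = 0" for i
      proof -
        have "(p1 + q + (2 * pi) *\<^sub>R lat_to_real k) $ i = p1 $ i"
          by (simp only: eq)
        then have qi: "q $ i = - (2 * pi) * of_int (k $ i)"
          by (simp add: lat_to_real_def)
        have "- pi \<le> q $ i" "q $ i \<le> pi"
          using q by (auto simp: mem_pi_cube)
        then have "\<bar>q $ i\<bar> \<le> pi"
          by linarith
        then have "2 * \<bar>of_int (k $ i) :: real\<bar> * pi \<le> 1 * pi"
          unfolding qi by (simp add: abs_mult mult_ac)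
        then have "2 * \<bar>of_int (k $ i) :: real\<bar> \<le> 1"
          using pi_gt_zero by (simp only: mult_le_cancel_right_pos)
        then have "k $ i = 0"
          by linarith
        then show ?thesis
          using qi by simp
      qed
      then show False
        using q by (simp add: vec_eq_iff)
    qed
    from maxpt(2)[OF k this] show ?thesis
      by (simp add: disp_periodic)
  qed
  obtain c r where c: "c > 0" "r > 0"
    "\<And>q. q \<in> ball p1 r \<Longrightarrow> c * (norm (q - p1))\<^sup>2 \<le> disp eh p1 - disp eh q"
    using nondegenerate_max_quadratic_bound[OF C2 glob] by blast
  have comp: "compact (pi_cube - ball 0 r)"
    by (simp add: pi_cube_def compact_diff)
  have cont: "continuous_on S (\<lambda>q. disp eh p1 - disp eh (p1 + q))" for S
    by (intro continuous_intros continuous_on_compose2[OF continuous_on_disp[OF l1, of UNIV]]) auto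
  obtain m where m: "m > 0" "\<And>q. q \<in> pi_cube - ball 0 r \<Longrightarrow> m \<le> disp eh p1 - disp eh (p1 + q)"
  proof (cases "pi_cube - ball 0 r = ({} :: (real^'n) set)")
    case True
    then show ?thesis by (intro that[of 1]) auto
  next
    case False
    obtain q0 where q0: "q0 \<in> pi_cube - ball 0 r"
      "\<forall>q\<in>pi_cube - ball 0 r. disp eh p1 - disp eh (p1 + q0) \<le> disp eh p1 - disp eh (p1 + q)"
      using continuous_attains_inf[OF comp False cont] by blast
    then have "q0 \<noteq> 0" "q0 \<in> pi_cube"
      using c(2) by auto
    then show ?thesis
      using strict[of q0] q0(2) by (intro that[of "disp eh p1 - disp eh (p1 + q0)"]) auto
  qed
  have "bounded (pi_cube :: (real^'n) set)"
    by (simp add: pi_cube_def)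
  then obtain M where M: "M > 0" "\<And>q::real^'n. q \<in> pi_cube \<Longrightarrow> norm q \<le> M"
    using bounded_pos by blast
  show ?thesis
  \<comment> \<open>Away from the ball the gap is at least \<open>m\<close>, and
    \<open>|q| \<le> M\<close> makes this at least \<open>m / M^2 * |q|^2\<close>.\<close>
  proof (rule that[of "min c (m / M\<^sup>2)"])
    show "min c (m / M\<^sup>2) > 0"
      using c m M by simp
    fix q :: "real^'n" assume q: "q \<in> pi_cube"
    show "min c (m / M\<^sup>2) * (norm q)\<^sup>2 \<le> disp eh p1 - disp eh (p1 + q)"
    proof (cases "norm q < r")
      case True
      have "min c (m / M\<^sup>2) * (norm q)\<^sup>2 \<le> c * (norm q)\<^sup>2"
        by (intro mult_right_mono) auto
      also have "\<dots> \<le> disp eh p1 - disp eh (p1 + q)"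
        using c(3)[of "p1 + q"] True by (simp add: dist_norm)
      finally show ?thesis .
    next
      case False
      have "min c (m / M\<^sup>2) * (norm q)\<^sup>2 \<le> m / M\<^sup>2 * M\<^sup>2"
        using m M q by (intro mult_mono power_mono) auto
      also have "\<dots> \<le> disp eh p1 - disp eh (p1 + q)"
        using m(2)[of q] q False M by simp
      finally show ?thesis .
    qed
  qed
qed

section \<open>Integration over the period cube\<close>

text \<open>Fubini for products of one-variable functions. \<open>lborel_eq\<close> presents
  Lebesgue measure as the image of a product measure indexed by basis vectors, so the factors are
  reindexed along the bijection sending \<open>i\<close> to \<open>axis i 1\<close>.\<close>

lemma
  fixes f :: "'n::finite \<Rightarrow> real \<Rightarrow> 'b::{real_normed_field,banach,second_countable_topology}"
  assumes int: "\<And>i. integrable lborel (f i)"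
  shows integrable_lborel_cart_prod: "integrable lborel (\<lambda>x::real^'n. \<Prod>i\<in>UNIV. f i (x $ i))"
    and integral_lborel_cart_prod:
      "(\<integral>x. (\<Prod>i\<in>UNIV. f i (x $ i)) \<partial>(lborel :: (real^'n) measure)) = (\<Prod>i\<in>UNIV. integral\<^sup>L lborel (f i))"
proof -
  interpret product_sigma_finite "\<lambda>_::real^'n. lborel :: real measure" ..
  define g where "g b = f (axis_index b)" for b :: "real^'n"
  have Basis: "(Basis :: (real^'n) set) = range (\<lambda>i. axis i 1)"
    by (auto simp: Basis_vec_def)
  have inj: "inj (\<lambda>i::'n. axis i (1::real))"
    by (auto simp: inj_def axis_eq_axis)
  have idx: "axis_index (axis i 1 :: real^'n) = i" for i
    by (simp add: axis_index_def axis_eq_axis)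
  have [measurable]: "f i \<in> borel_measurable borel" for i
    using borel_measurable_integrable[OF int[of i]] by simp
  have [measurable]: "g b \<in> borel_measurable borel" for b
    by (simp add: g_def)
  have int_g: "integrable lborel (g b)" for b
    by (simp add: g_def int)
  have meas: "(\<lambda>x. \<Sum>b\<in>(Basis::(real^'n) set). x b *\<^sub>R b) \<in> measurable (\<Pi>\<^sub>M b\<in>(Basis::(real^'n) set). lborel) borel"
    by measurable
  have prod_eq: "(\<Prod>i\<in>UNIV. f i (x $ i)) = (\<Prod>b\<in>Basis. g b (x \<bullet> b))" for x :: "real^'n"
    unfolding Basis by (subst prod.reindex[OF inj]) (simp add: g_def idx inner_axis)
  have eq: "(\<Prod>i\<in>UNIV. f i ((\<Sum>b\<in>Basis. x b *\<^sub>R b) $ i)) = (\<Prod>b\<in>Basis. g b (x b))"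
    for x :: "real^'n \<Rightarrow> real"
    unfolding prod_eq by simp
  have pm: "(\<lambda>x::real^'n. \<Prod>i\<in>UNIV. f i (x $ i)) \<in> borel_measurable borel"
    unfolding prod_eq by measurable
  show "integrable lborel (\<lambda>x::real^'n. \<Prod>i\<in>UNIV. f i (x $ i))"
    unfolding lborel_eq[where 'a = "real^'n"] integrable_distr_eq[OF meas pm] eq
    by (rule product_integrable_prod) (auto simp: int_g)
  have "(\<integral>x. (\<Prod>i\<in>UNIV. f i (x $ i)) \<partial>(lborel :: (real^'n) measure)) = (\<Prod>b\<in>Basis. integral\<^sup>L lborel (g b))"
    unfolding lborel_eq[where 'a = "real^'n"] integral_distr[OF meas pm] eq
    by (rule product_integral_prod) (auto simp: int_g)
  also have "\<dots> = (\<Prod>i\<in>UNIV. integral\<^sup>L lborel (f i))"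
    unfolding Basis by (subst prod.reindex[OF inj]) (simp add: g_def idx)
  finally show "(\<integral>x. (\<Prod>i\<in>UNIV. f i (x $ i)) \<partial>(lborel :: (real^'n) measure)) = (\<Prod>i\<in>UNIV. integral\<^sup>L lborel (f i))" .
qed

text \<open>Not normalised: the mass \<open>(2 * pi) ^ CARD('n)\<close> is carried through the
  Fourier identities and ends up in the constant of the pointwise bound.\<close>

definition cube_measure :: "(real^'n) measure" where
  "cube_measure = restrict_space lborel pi_cube"

lemma compact_pi_cube: "compact pi_cube"
  by (simp add: pi_cube_def)

lemma pi_cube_sets [measurable, simp]: "pi_cube \<in> sets borel"
  by (simp add: pi_cube_def)

lemma space_cube_measure [simp]: "space cube_measure = pi_cube"
  by (simp add: cube_measure_def space_restrict_space)

lemma integrable_cube_continuous: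
  fixes f :: "real^'n \<Rightarrow> 'b::{banach, second_countable_topology}"
  assumes "continuous_on pi_cube f"
  shows "integrable cube_measure f"
  using borel_integrable_compact[OF compact_pi_cube assms]
  by (simp add: cube_measure_def integrable_restrict_space)

lemma indicator_pi_cube: "indicator pi_cube q = (\<Prod>i\<in>UNIV. indicat_real {-pi..pi} (q $ i))"
proof (cases "q \<in> pi_cube")
  case True
  then show ?thesis by (simp add: mem_pi_cube indicator_def)
next
  case False
  then obtain i where "q $ i \<notin> {-pi..pi}"
    by (auto simp: mem_pi_cube)
  then have "indicat_real {-pi..pi} (q $ i) = 0"
    by simp
  then have "(\<Prod>i\<in>UNIV. indicat_real {-pi..pi} (q $ i)) = 0"
    by (intro prod_zero) auto
  then show ?thesis
    using False by simp
qed

lemma integral_cis_period: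
  "(\<integral>t. indicat_real {-pi..pi} t *\<^sub>R cis (of_int k * t) \<partial>lborel) = (if k = 0 then 2 * pi else 0)"
proof (cases "k = 0")
  case True
  then show ?thesis
    by (simp add: scaleR_conv_of_real)
next
  case False
  have "(\<integral>t. indicat_real {-pi..pi} t *\<^sub>R cis (of_int k * t) \<partial>lborel)
    = cis (of_int k * pi) / (\<i> * of_int k) - cis (of_int k * (- pi)) / (\<i> * of_int k)"
  proof (rule integral_FTC_Icc)
    show "((\<lambda>t. cis (of_int k * t) / (\<i> * of_int k)) has_vector_derivative cis (of_int k * x)) (at x within {-pi..pi})" for x
      using False
      by (auto intro!: derivative_eq_intros simp: has_vector_derivative_def scaleR_conv_of_real fun_eq_iff complex_eq_iff)
  qed (auto intro!: continuous_intros)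
  also have "cis (of_int k * pi) = cis (of_int k * (- pi) + 2 * pi * of_int k)"
    by (simp add: algebra_simps)
  also have "\<dots> = cis (of_int k * (- pi))"
    by (simp only: cis_mult[symmetric] cis_multiple_2pi[OF Ints_of_int]) simp
  finally show ?thesis
    using False by simp
qed

lemma cis_sum: "finite A \<Longrightarrow> cis (\<Sum>i\<in>A. f i) = (\<Prod>i\<in>A. cis (f i))"
  by (induction rule: finite_induct) (auto simp: cis_mult[symmetric])

text \<open>Orthogonality of characters, by factorising both the indicator of the cube and the
  exponential over the coordinates.\<close>

lemma integral_cube_cis:
  fixes z :: "int^'n"
  shows "(\<integral>q. cis (lat_to_real z \<bullet> q) \<partial>cube_measure) = (if z = 0 then (2 * pi) ^ CARD('n) else 0)"
proof -
  let ?f = "\<lambda>i t. indicat_real {-pi..pi} t *\<^sub>R cis (of_int (z $ i) * t)"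
  have int: "integrable lborel (?f i)" for i
    by (rule borel_integrable_compact) (auto intro!: continuous_intros)
  have "indicator pi_cube q *\<^sub>R cis (lat_to_real z \<bullet> q) = (\<Prod>i\<in>UNIV. ?f i (q $ i))" for q :: "real^'n"
    by (simp add: indicator_pi_cube lat_to_real_def inner_vec_def cis_sum scaleR_conv_of_real prod.distrib)
  then have "(\<integral>q. cis (lat_to_real z \<bullet> q) \<partial>cube_measure) = (\<integral>q. (\<Prod>i\<in>UNIV. ?f i (q $ i)) \<partial>lborel)"
    by (simp add: cube_measure_def integral_restrict_space)
  also have "\<dots> = (\<Prod>i\<in>UNIV. if z $ i = 0 then complex_of_real (2 * pi) else 0)"
    by (subst integral_lborel_cart_prod[OF int]) (simp add: integral_cis_period if_distrib[of complex_of_real] cong: if_cong)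
  also have "\<dots> = (if z = 0 then (2 * pi) ^ CARD('n) else 0)"
    by (auto simp: vec_eq_iff)
  finally show ?thesis .
qed

text \<open>On a coordinate hyperplane a factor \<open>0 powr a = 0\<close> makes
  \<open>cube_weight\<close> vanish, so its use as an upper bound has to exclude these null
  sets.\<close>

lemma AE_cube_nonzero: "AE q in (cube_measure :: (real^'n) measure). \<forall>i. q $ i \<noteq> 0"
proof -
  have "AE q in (lborel :: (real^'n) measure). q $ i \<noteq> 0" for i :: 'n
  proof -
    have "{q::real^'n. q $ i = 0} \<in> null_sets lebesgue"
      using negligible_standard_hyperplane_cart[of i] negligible_iff_null_sets by blast
    moreover have "{q::real^'n. q $ i = 0} \<in> sets borel"
      by measurable
    ultimately have "{q::real^'n. q $ i = 0} \<in> null_sets lborel"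
      by (simp add: null_sets_completion_iff)
    from AE_not_in[OF this] show ?thesis
      by simp
  qed
  then have "AE q in (lborel :: (real^'n) measure). \<forall>i. q $ i \<noteq> 0"
    by (simp add: AE_all_countable)
  then show ?thesis
    unfolding cube_measure_def by (subst AE_restrict_space_iff) auto
qed

section \<open>Singular weights on the cube\<close>

lemma integrable_powr_interval:
  assumes "a > -1"
  shows "integrable lborel (\<lambda>t. indicat_real {-pi..pi} t *\<^sub>R (\<bar>t\<bar> powr a))"
proof -
  let ?g = "\<lambda>t::real. indicat_real {0..pi} t *\<^sub>R (t powr a)"
  have g: "integrable lborel ?g"
  proof -
    have "(\<lambda>t. t powr a) absolutely_integrable_on {0..pi}"
      using integrable_on_powr_from_0[OF assms] by (intro nonnegative_absolutely_integrable_1) auto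
    then have "integrable lebesgue ?g"
      by (simp add: set_integrable_def)
    then show ?thesis
      by (subst (asm) integrable_completion) measurable
  qed
  have g': "integrable lborel (\<lambda>t. ?g (- t))"
    using lborel_integrable_real_affine[OF g, of "-1" 0] by simp
  show ?thesis
  proof (rule Bochner_Integration.integrable_bound[OF Bochner_Integration.integrable_add[OF g g']])
    show "(\<lambda>t. indicat_real {-pi..pi} t *\<^sub>R (\<bar>t\<bar> powr a)) \<in> borel_measurable lborel"
      by measurable
  qed (auto simp: indicator_def)
qed

text \<open>A product majorant of \<open>|q| powr (g - d)\<close>, where
  \<open>d = CARD('n)\<close>. The power is split evenly over the coordinates; for
  \<open>g \<le> d\<close> the exponent is at most 0, so \<open>|q $ i| \<le> |q|\<close> makes each
  factor larger, and for \<open>g > 0\<close> it exceeds -1, so integrability is a one-dimensional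
  fact and no polar coordinates are required.\<close>

definition cube_weight :: "real \<Rightarrow> real^'n \<Rightarrow> real" where
  "cube_weight g q = (\<Prod>i\<in>UNIV. \<bar>q $ i\<bar> powr (g / CARD('n) - 1))"

lemma cube_weight_nonneg: "0 \<le> cube_weight g q"
  by (simp add: cube_weight_def prod_nonneg)

lemma integrable_cube_weight:
  assumes "g > 0"
  shows "integrable cube_measure (cube_weight g :: real^'n \<Rightarrow> real)"
proof -
  have "integrable lborel (\<lambda>q::real^'n. \<Prod>i\<in>UNIV. indicat_real {-pi..pi} (q $ i) *\<^sub>R (\<bar>q $ i\<bar> powr (g / CARD('n) - 1)))"
    using assms by (intro integrable_lborel_cart_prod integrable_powr_interval) auto
  then show ?thesis
    by (simp add: cube_measure_def integrable_restrict_space indicator_pi_cube cube_weight_def prod.distrib)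
qed

lemma norm_powr_le_cube_weight:
  fixes q :: "real^'n"
  assumes "\<forall>i. q $ i \<noteq> 0" "g \<le> real CARD('n)"
  shows "norm q powr (g - real CARD('n)) \<le> cube_weight g q"
proof -
  have q: "norm q > 0"
    using assms(1) by (metis zero_index zero_less_norm_iff)
  have "norm q powr (g - real CARD('n)) = (\<Prod>i\<in>(UNIV::'n set). norm q powr (g / CARD('n) - 1))"
    using q by (simp add: powr_power algebra_simps)
  also have "\<dots> \<le> cube_weight g q"
    unfolding cube_weight_def
  proof (intro prod_mono conjI)
    show "norm q powr (g / CARD('n) - 1) \<le> \<bar>q $ i\<bar> powr (g / CARD('n) - 1)" for i
      using assms q by (intro powr_mono2') (auto simp: component_le_norm_cart field_simps)
  qed auto
  finally show ?thesis .
qed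

text \<open>Interpolates between two elementary bounds: \<open>2 * |sin (t / 2)| \<le> |t|\<close>
  for small \<open>t\<close>, where lowering the exponent from 2 to \<open>s\<close> only helps, and
  the trivial bound 2 for \<open>|t| > 1\<close>.\<close>

lemma cmod_cis_minus_one_le:
  assumes "0 \<le> s" "s \<le> 2"
  shows "(cmod (cis t - 1))\<^sup>2 \<le> 4 * \<bar>t\<bar> powr s"
proof (cases "\<bar>t\<bar> \<le> 1")
  case True
  show ?thesis
  proof (cases "t = 0")
    case False
    have "(cmod (cis t - 1))\<^sup>2 = 2 - 2 * cos t"
      using sin_cos_squared_add[of t] by (simp add: cmod_power2 power2_diff)
    also have "\<dots> = 4 * \<bar>sin (t / 2)\<bar>\<^sup>2"
      using cos_double_sin[of "t / 2"] by simp
    also have "\<dots> \<le> 4 * \<bar>t / 2\<bar>\<^sup>2"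
      by (intro mult_left_mono power_mono abs_sin_x_le_abs_x) auto
    also have "\<dots> = \<bar>t\<bar> powr 2"
      using False by (simp add: power_divide)
    finally have "(cmod (cis t - 1))\<^sup>2 \<le> \<bar>t\<bar> powr 2" .
    also have "\<dots> \<le> \<bar>t\<bar> powr s"
      using True False assms by (intro powr_mono') auto
    finally show ?thesis
      using powr_ge_zero[of "\<bar>t\<bar>" s] by linarith
  qed auto
next
  case False
  have "cmod (cis t - 1) \<le> 2"
    using norm_triangle_ineq4[of "cis t" 1] by simp
  then have "(cmod (cis t - 1))\<^sup>2 \<le> 2\<^sup>2"
    by (intro power_mono) auto
  also have "\<dots> \<le> 4 * \<bar>t\<bar> powr s"
    using False assms by (simp add: ge_one_powr_ge_zero)
  finally show ?thesis .
qed

section \<open>The pointwise bound for finitely supported functions\<close>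

lemma lat_to_real_add: "lat_to_real (x + y) = lat_to_real x + lat_to_real y"
  and lat_to_real_diff: "lat_to_real (x - y) = lat_to_real x - lat_to_real y"
  and lat_to_real_0: "lat_to_real 0 = 0"
  by (simp_all add: lat_to_real_def vec_eq_iff)

text \<open>Gives access to the interchange of uniform limits with the gauge integral, used for the
  Fourier coefficients of \<open>disp_c\<close>.\<close>

lemma integral_cube_eq_HK:
  fixes f :: "real^'n \<Rightarrow> complex"
  assumes "continuous_on pi_cube f"
  shows "integral\<^sup>L cube_measure f = integral pi_cube f"
  using set_borel_integral_eq_integral(2)[of pi_cube f] borel_integrable_compact[OF compact_pi_cube assms]
  by (simp add: cube_measure_def integral_restrict_space set_integrable_def set_lebesgue_integral_def)

lemma integral_cube_cis_shift:
  fixes z :: "int^'n"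
  shows "(\<integral>q. cis (lat_to_real z \<bullet> (p + q)) \<partial>cube_measure) = (if z = 0 then (2 * pi) ^ CARD('n) else 0)"
  by (simp add: inner_add_right cis_mult[symmetric] integral_cube_cis lat_to_real_0)

text \<open>The series converges uniformly, so it may be integrated termwise. By orthogonality the
  partial integrals are constant as soon as the finite set contains \<open>- z\<close>, which
  identifies the limit.\<close>

lemma integral_cube_disp:
  fixes eh :: "int^'n \<Rightarrow> complex"
  assumes l1: "(\<lambda>x. norm (eh x)) summable_on UNIV"
  shows "(\<integral>q. disp_c eh (p + q) * cis (lat_to_real z \<bullet> (p + q)) \<partial>cube_measure) = (2 * pi) ^ CARD('n) * eh (- z)"
proof -
  let ?g = "\<lambda>X q. \<Sum>x\<in>X. eh x * cis (lat_to_real x \<bullet> (p + q)) * cis (lat_to_real z \<bullet> (p + q))"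
  let ?h = "\<lambda>q. disp_c eh (p + q) * cis (lat_to_real z \<bullet> (p + q))"
  let ?F = "finite_subsets_at_top (UNIV :: (int^'n) set)"
  have "uniform_limit pi_cube ?g (\<lambda>q. \<Sum>\<^sub>\<infinity>x. eh x * cis (lat_to_real x \<bullet> (p + q)) * cis (lat_to_real z \<bullet> (p + q))) ?F"
    by (rule Weierstrass_m_test_general[where M = "\<lambda>x. norm (eh x)"]) (auto simp: norm_mult l1)
  then have "uniform_limit pi_cube ?g ?h ?F"
    by (simp add: infsum_cmult_left' disp_c_def)
  then obtain I J where I: "\<And>X. (?g X has_integral I X) pi_cube" and J: "(?h has_integral J) pi_cube"
    and lim: "(I \<longlongrightarrow> J) ?F"
    unfolding pi_cube_def by (rule uniform_limit_integral_cbox) (auto intro!: continuous_intros)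
  have I_eq: "I X = (\<Sum>x\<in>X. if x = - z then (2 * pi) ^ CARD('n) * eh (- z) else 0)" for X
  proof -
    have "I X = integral pi_cube (?g X)"
      using I[of X] by (simp add: integral_unique)
    also have "\<dots> = (\<integral>q. ?g X q \<partial>cube_measure)"
      by (subst integral_cube_eq_HK) (auto intro!: continuous_intros)
    also have "\<dots> = (\<integral>q. (\<Sum>x\<in>X. eh x * cis (lat_to_real (x + z) \<bullet> (p + q))) \<partial>cube_measure)"
      by (simp add: mult.assoc cis_mult lat_to_real_add inner_add_left)
    also have "\<dots> = (\<Sum>x\<in>X. (\<integral>q. eh x * cis (lat_to_real (x + z) \<bullet> (p + q)) \<partial>cube_measure))"
      by (intro Bochner_Integration.integral_sum integrable_cube_continuous continuous_intros)
    also have "\<dots> = (\<Sum>x\<in>X. if x = - z then (2 * pi) ^ CARD('n) * eh (- z) else 0)"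
      by (intro sum.cong refl) (auto simp: integral_cube_cis_shift add_eq_0_iff2)
    finally show ?thesis .
  qed
  have "eventually (\<lambda>X. I X = (2 * pi) ^ CARD('n) * eh (- z)) ?F"
    unfolding eventually_finite_subsets_at_top
    by (intro exI[of _ "{- z}"]) (auto simp: I_eq)
  then have "(I \<longlongrightarrow> (2 * pi) ^ CARD('n) * eh (- z)) ?F"
    by (rule tendsto_eventually)
  with lim have "J = (2 * pi) ^ CARD('n) * eh (- z)"
    by (intro tendsto_unique[OF finite_subsets_at_top_neq_bot])
  moreover have "continuous_on pi_cube ?h"
    by (intro continuous_intros continuous_on_compose2[OF continuous_on_disp_c[OF l1, of UNIV]]) auto
  ultimately show ?thesis
    using J by (simp add: integral_cube_eq_HK integral_unique)
qed

text \<open>Recovers the product form of Cauchy-Schwarz from its version with a free parameter. The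
  optimal choice is \<open>t = a / b\<close>; if \<open>b = 0\<close>, a large \<open>t\<close>
  forces \<open>a = 0\<close>, and \<open>(k + 1) / (m * a)\<close> is large enough.\<close>

lemma AM_GM_optimise:
  fixes m a b k :: real
  assumes m: "m > 0" and a: "a \<ge> 0" and b: "b \<ge> 0" and k: "k \<ge> 0"
    and le: "\<And>t. t > 0 \<Longrightarrow> 2 * (m * a) \<le> t * (m * b) + k / t"
  shows "m * a\<^sup>2 \<le> k * b"
proof (cases "a = 0")
  case True
  then show ?thesis using b k by simp
next
  case False
  with a have "a > 0" by simp
  show ?thesis
  proof (cases "b = 0")
    case True
    have "2 * (m * a) \<le> k / ((k + 1) / (m * a))"
      using le[of "(k + 1) / (m * a)"] m \<open>a > 0\<close> k True by simp
    also have "\<dots> \<le> m * a"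
      using m \<open>a > 0\<close> k by (simp add: field_simps)
    finally show ?thesis
      using m \<open>a > 0\<close> by simp
  next
    case False
    with b have "b > 0" by simp
    have "2 * (m * a) \<le> a / b * (m * b) + k / (a / b)"
      using le[of "a / b"] \<open>a > 0\<close> \<open>b > 0\<close> by simp
    also have "\<dots> = m * a + k * b / a"
      using \<open>b > 0\<close> by (simp add: field_simps)
    finally have "m * a \<le> k * b / a"
      by linarith
    then show ?thesis
      using \<open>a > 0\<close> by (simp add: field_simps power2_eq_square)
  qed
qed

text \<open>The quadratic form of \<open>e - h0\<close> at the restriction of \<open>f\<close> to
  \<open>A\<close>; for finite \<open>A\<close> it raises no question of convergence.\<close>

definition energy_on :: "(int^'n \<Rightarrow> complex) \<Rightarrow> real \<Rightarrow> (int^'n) set \<Rightarrow> (int^'n \<Rightarrow> complex) \<Rightarrow> complex" where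
  "energy_on eh e A f =
     of_real e * (\<Sum>z\<in>A. f z * cnj (f z)) - (\<Sum>(y, z)\<in>A \<times> A. eh (z - y) * f z * cnj (f y))"

text \<open>Plancherel with a weight: expand \<open>|F|^2\<close> into characters and integrate each
  against \<open>e - disp\<close>. The minus sign in the exponent of \<open>F\<close> is deliberate:
  \<open>h0\<close> shifts by \<open>x + y\<close>, and only with this sign does it become
  multiplication by \<open>disp\<close> itself rather than by its reflection.\<close>

lemma energy_on_eq_integral:
  fixes eh f :: "int^'n \<Rightarrow> complex" and p :: "real^'n"
  assumes l1: "(\<lambda>x. norm (eh x)) summable_on UNIV"
    and sym: "\<And>x. cnj (eh (- x)) = eh x" and "finite A"
  defines "F \<equiv> \<lambda>q. \<Sum>z\<in>A. f z * cis (- (lat_to_real z \<bullet> (p + q)))"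
  shows "(\<integral>q. (e - disp eh (p + q)) * (cmod (F q))\<^sup>2 \<partial>cube_measure) = (2 * pi) ^ CARD('n) * Re (energy_on eh e A f)"
proof -
  let ?w = "\<lambda>y z q. cis (lat_to_real (y - z) \<bullet> (p + q))"
  let ?G = "\<lambda>y z q. f z * cnj (f y) * (of_real e * ?w y z q - disp_c eh (p + q) * ?w y z q)"
  have pt: "complex_of_real ((e - disp eh (p + q)) * (cmod (F q))\<^sup>2) = (\<Sum>(y, z)\<in>A \<times> A. ?G y z q)" for q
  proof -
    have "complex_of_real ((e - disp eh (p + q)) * (cmod (F q))\<^sup>2)
      = (of_real e - disp_c eh (p + q)) * (cnj (F q) * F q)"
      using complex_norm_square[of "F q"]
      by (simp add: disp_c_eq_disp[of eh, OF sym] mult.commute)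
    also have "cnj (F q) * F q = (\<Sum>y\<in>A. \<Sum>z\<in>A. f z * cnj (f y) * ?w y z q)"
      unfolding F_def
      by (simp add: sum_product cis_cnj lat_to_real_diff inner_diff_left cis_divide[symmetric]
          cis_mult[symmetric] cis_inverse[symmetric] field_simps) (rule sum.swap)
    finally show ?thesis
      by (simp add: sum.cartesian_product[symmetric] sum_distrib_left algebra_simps sum_subtractf)
  qed
  have cd: "continuous_on pi_cube (\<lambda>q. disp_c eh (p + q))"
    by (intro continuous_intros continuous_on_compose2[OF continuous_on_disp_c[OF l1, of UNIV]]) auto
  have "complex_of_real (\<integral>q. (e - disp eh (p + q)) * (cmod (F q))\<^sup>2 \<partial>cube_measure)
    = (\<integral>q. (\<Sum>(y, z)\<in>A \<times> A. ?G y z q) \<partial>cube_measure)"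
    unfolding pt[symmetric] by (rule integral_complex_of_real[symmetric])
  also have "\<dots> = (\<Sum>(y, z)\<in>A \<times> A. (\<integral>q. ?G y z q \<partial>cube_measure))"
    unfolding split_def
    by (intro Bochner_Integration.integral_sum integrable_cube_continuous continuous_intros cd)
  also have "\<dots> = (\<Sum>(y, z)\<in>A \<times> A. (2 * pi) ^ CARD('n) *
      ((if z = y then of_real e * (f z * cnj (f z)) else 0) - eh (z - y) * f z * cnj (f y)))"
  proof (intro sum.cong refl, clarify)
    fix y z
    have "(\<integral>q. of_real e * ?w y z q - disp_c eh (p + q) * ?w y z q \<partial>cube_measure)
      = of_real e * (\<integral>q. ?w y z q \<partial>cube_measure) - (\<integral>q. disp_c eh (p + q) * ?w y z q \<partial>cube_measure)"
      by (subst Bochner_Integration.integral_diff) (auto intro!: integrable_cube_continuous continuous_intros cd)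
    also have "\<dots> = of_real e * (if y = z then (2 * pi) ^ CARD('n) else 0) - (2 * pi) ^ CARD('n) * eh (z - y)"
      using integral_cube_disp[OF l1, of p "y - z"] by (simp add: integral_cube_cis_shift)
    finally have "(\<integral>q. ?G y z q \<partial>cube_measure) = f z * cnj (f y) *
      (of_real e * (if y = z then (2 * pi) ^ CARD('n) else 0) - (2 * pi) ^ CARD('n) * eh (z - y))"
      by (simp only: integral_mult_right_zero)
    then show "(\<integral>q. ?G y z q \<partial>cube_measure) = (2 * pi) ^ CARD('n) *
      ((if z = y then of_real e * (f z * cnj (f z)) else 0) - eh (z - y) * f z * cnj (f y))"
      by (cases "y = z") (simp_all only: if_True if_False, simp_all add: algebra_simps)
  qed
  also have "\<dots> = (2 * pi) ^ CARD('n) * energy_on eh e A f"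
  proof -
    have "(\<Sum>(y, z)\<in>A \<times> A. if z = y then of_real e * (f z * cnj (f z)) else 0)
      = of_real e * (\<Sum>z\<in>A. f z * cnj (f z))"
      using \<open>finite A\<close> by (simp add: sum.cartesian_product[symmetric] sum_distrib_left)
    then show ?thesis
      by (simp add: energy_on_def sum_distrib_left[symmetric] split_def sum_subtractf)
  qed
  finally have "Re (complex_of_real (\<integral>q. (e - disp eh (p + q)) * (cmod (F q))\<^sup>2 \<partial>cube_measure))
    = Re (complex_of_real ((2 * pi) ^ CARD('n)) * energy_on eh e A f)"
    by simp
  then show ?thesis
    by (simp only: Re_complex_of_real times_complex.sel Im_complex_of_real)
qed

text \<open>Stated for truncations, with \<open>C\<close> chosen before \<open>A\<close>,
  \<open>f\<close> and \<open>x\<close>, so that it survives the limit over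
  \<open>A\<close>.\<close>

lemma finite_support_bound:
  fixes eh :: "int^'n \<Rightarrow> complex"
  assumes dim: "CARD('n) \<le> 2"
    and l1: "(\<lambda>x. norm (eh x)) summable_on UNIV"
    and sym: "\<And>x. cnj (eh (- x)) = eh x"
    and c: "c > 0" "\<And>q. q \<in> pi_cube \<Longrightarrow> c * (norm q)\<^sup>2 \<le> disp eh p - disp eh (p + q)"
    and gam: "0 < \<gamma>" "\<gamma> < 1"
  defines "s \<equiv> 2 - real CARD('n) + \<gamma>"
  obtains C where "C > 0"
    "\<And>A f x. finite A \<Longrightarrow> x \<in> A \<Longrightarrow> f 0 = 0 \<Longrightarrow>
       (cmod (f x))\<^sup>2 \<le> C * lat_norm x powr s * Re (energy_on eh (disp eh p) A f)"
proof -
  define m where "m = (2 * pi) ^ CARD('n)"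
  have m: "m > 0" by (simp add: m_def)
  define J where "J = (\<integral>q. cube_weight \<gamma> q \<partial>(cube_measure :: (real^'n) measure))"
  have J: "J \<ge> 0"
    unfolding J_def by (intro Bochner_Integration.integral_nonneg) (simp add: cube_weight_nonneg)
  have "CARD('n) \<ge> 1" by (simp add: Suc_leI)
  then have "real CARD('n) \<ge> 1" by linarith
  \<comment> \<open>The dimension enters here: \<open>d \<le> 2\<close> gives
    \<open>s \<ge> 0\<close>, while \<open>d \<ge> 1\<close> and \<open>\<gamma> < 1\<close> give
    \<open>s \<le> 2\<close>. The exponent \<open>s - 2\<close> is the one that
    \<open>cube_weight \<gamma>\<close> majorises.\<close>
  then have s: "0 \<le> s" "s \<le> 2" "s - 2 = \<gamma> - real CARD('n)" "\<gamma> \<le> real CARD('n)"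
    using dim gam unfolding s_def by linarith+
  have main: "m * (cmod (f x))\<^sup>2 \<le> (4 / c * lat_norm x powr s * J) * Re (energy_on eh (disp eh p) A f)"
    "0 \<le> Re (energy_on eh (disp eh p) A f)"
    if A: "finite A" "x \<in> A" and f0: "f 0 = 0" for A f x
  proof -
    define F where "F = (\<lambda>q. \<Sum>z\<in>A. f z * cis (- (lat_to_real z \<bullet> (p + q))))"
    define D where "D = (\<lambda>q. disp eh p - disp eh (p + q))"
    define b where "b = (\<lambda>q. cmod (cis (lat_to_real x \<bullet> q) - 1))"
    have contF: "continuous_on S F" for S
      unfolding F_def by (intro continuous_intros)
    have contD: "continuous_on S D" for S
      unfolding D_def by (intro continuous_intros continuous_on_compose2[OF continuous_on_disp[OF l1, of UNIV]]) auto
    have contb: "continuous_on S b" for S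
      unfolding b_def by (intro continuous_intros)
    have D: "D q \<ge> c * (norm q)\<^sup>2" if "q \<in> pi_cube" for q
      using c(2)[OF that] by (simp add: D_def)
    have D0: "D q \<ge> 0" if "q \<in> pi_cube" for q
      using D[OF that] c(1) by (meson mult_nonneg_nonneg less_imp_le order_trans zero_le_power2)
    have ints: "integrable cube_measure (\<lambda>q. D q * (cmod (F q))\<^sup>2)" "integrable cube_measure (\<lambda>q. cmod (F q) * b q)"
      by (intro integrable_cube_continuous continuous_intros contF contD contb)+
    have energy: "(\<integral>q. D q * (cmod (F q))\<^sup>2 \<partial>cube_measure) = m * Re (energy_on eh (disp eh p) A f)"
      unfolding D_def F_def m_def by (rule energy_on_eq_integral[OF l1 sym A(1)])
    have "0 \<le> (\<integral>q. D q * (cmod (F q))\<^sup>2 \<partial>cube_measure)"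
      by (intro Bochner_Integration.integral_nonneg) (auto simp: D0)
    then show en0: "Re (energy_on eh (disp eh p) A f) \<ge> 0"
      using m by (simp add: energy zero_le_mult_iff)
    \<comment> \<open>The coefficient at 0 vanishes in either case: \<open>f 0 = 0\<close> if 0 lies
      in \<open>A\<close>, and the \<open>if\<close> otherwise.\<close>
    have coeff: "(\<integral>q. F q * cis (lat_to_real y \<bullet> (p + q)) \<partial>cube_measure) = m * (if y \<in> A then f y else 0)" for y
    proof -
      have "(\<integral>q. F q * cis (lat_to_real y \<bullet> (p + q)) \<partial>cube_measure)
        = (\<integral>q. (\<Sum>z\<in>A. f z * cis (lat_to_real (y - z) \<bullet> (p + q))) \<partial>cube_measure)"
        by (simp add: F_def sum_distrib_right mult.assoc cis_mult lat_to_real_diff inner_diff_left)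
      also have "\<dots> = (\<Sum>z\<in>A. (\<integral>q. f z * cis (lat_to_real (y - z) \<bullet> (p + q)) \<partial>cube_measure))"
        by (intro Bochner_Integration.integral_sum integrable_cube_continuous continuous_intros)
      also have "\<dots> = (\<Sum>z\<in>A. if z = y then f y * m else 0)"
        by (intro sum.cong) (auto simp: integral_cube_cis_shift m_def)
      finally show ?thesis
        using A by simp
    qed
    \<comment> \<open>Subtracting a multiple of the zero coefficient leaves the integral equal to
      \<open>m * f x\<close>, but its kernel now vanishes at \<open>q = 0\<close>. The multiple is
      the phase of \<open>x\<close> at \<open>p\<close>, because that is where the weight
      \<open>D\<close> degenerates.\<close>
    have "(\<integral>q. F q * (cis (lat_to_real x \<bullet> (p + q)) - cis (lat_to_real x \<bullet> p)) \<partial>cube_measure)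
      = (\<integral>q. F q * cis (lat_to_real x \<bullet> (p + q)) - (F q * cis (lat_to_real 0 \<bullet> (p + q))) * cis (lat_to_real x \<bullet> p) \<partial>cube_measure)"
      by (simp add: lat_to_real_0 algebra_simps)
    also have "\<dots> = (\<integral>q. F q * cis (lat_to_real x \<bullet> (p + q)) \<partial>cube_measure)
      - (\<integral>q. F q * cis (lat_to_real 0 \<bullet> (p + q)) \<partial>cube_measure) * cis (lat_to_real x \<bullet> p)"
      by (subst Bochner_Integration.integral_diff) (auto intro!: integrable_cube_continuous continuous_intros contF)
    also have "\<dots> = m * f x"
      using A f0 by (simp only: coeff) simp
    finally have "m * cmod (f x) = cmod (\<integral>q. F q * (cis (lat_to_real x \<bullet> (p + q)) - cis (lat_to_real x \<bullet> p)) \<partial>cube_measure)"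
      using m by (simp add: norm_mult)
    also have "\<dots> \<le> (\<integral>q. cmod (F q * (cis (lat_to_real x \<bullet> (p + q)) - cis (lat_to_real x \<bullet> p))) \<partial>cube_measure)"
      by (rule integral_norm_bound)
    also have "\<dots> = (\<integral>q. cmod (F q) * b q \<partial>cube_measure)"
    proof -
      have "cis (lat_to_real x \<bullet> (p + q)) - cis (lat_to_real x \<bullet> p) = cis (lat_to_real x \<bullet> p) * (cis (lat_to_real x \<bullet> q) - 1)" for q
        by (simp add: inner_add_right cis_mult algebra_simps)
      then show ?thesis
        by (simp add: norm_mult b_def)
    qed
    finally have fx: "m * cmod (f x) \<le> (\<integral>q. cmod (F q) * b q \<partial>cube_measure)" .
    let ?K = "4 / c * lat_norm x powr s"
    \<comment> \<open>Of the power \<open>|q| powr s\<close>, a factor \<open>c * |q|^2\<close> is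
      paid for by \<open>D q\<close>; the remaining singular power goes into the integrable
      weight.\<close>
    have bD: "(b q)\<^sup>2 \<le> ?K * cube_weight \<gamma> q * D q" if q: "q \<in> pi_cube" "\<forall>i. q $ i \<noteq> 0" for q
    proof -
      have q0: "norm q > 0"
        using q(2) by (metis zero_index zero_less_norm_iff)
      have "(b q)\<^sup>2 \<le> 4 * \<bar>lat_to_real x \<bullet> q\<bar> powr s"
        unfolding b_def using s by (intro cmod_cis_minus_one_le)
      also have "\<dots> \<le> 4 * (lat_norm x * norm q) powr s"
        using s by (intro mult_left_mono powr_mono2) (auto simp: lat_norm_def Cauchy_Schwarz_ineq2)
      also have "\<dots> = ?K * norm q powr (s - 2) * (c * (norm q)\<^sup>2)"
        using q0 c by (simp add: powr_mult powr_diff lat_norm_def)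
      also have "\<dots> \<le> ?K * cube_weight \<gamma> q * D q"
        using c D[OF q(1)] norm_powr_le_cube_weight[OF q(2) s(4)] s(3)
        by (intro mult_mono) (auto simp: cube_weight_nonneg)
      finally show ?thesis .
    qed
    \<comment> \<open>Cauchy-Schwarz enters through the pointwise inequality between arithmetic and
      geometric mean, with a parameter \<open>t\<close> independent of \<open>q\<close> that is
      optimised at the end.\<close>
    have "2 * (m * cmod (f x)) \<le> t * (m * Re (energy_on eh (disp eh p) A f)) + (?K * J) / t" if t: "t > 0" for t
    proof -
      have "2 * (m * cmod (f x)) \<le> (\<integral>q. 2 * (cmod (F q) * b q) \<partial>cube_measure)"
        using fx by simp
      also have "\<dots> \<le> (\<integral>q. t * (D q * (cmod (F q))\<^sup>2) + ?K / t * cube_weight \<gamma> q \<partial>cube_measure)"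
      proof (rule integral_mono_AE)
        show "AE q in cube_measure. 2 * (cmod (F q) * b q) \<le> t * (D q * (cmod (F q))\<^sup>2) + ?K / t * cube_weight \<gamma> q"
          using AE_cube_nonzero AE_space
        proof eventually_elim
          case (elim q)
          then have q: "q \<in> pi_cube" by simp
          have q0: "norm q > 0"
            using elim(1) by (metis zero_index zero_less_norm_iff)
          have Dpos: "D q > 0"
            using D[OF q] q0 c by (smt (verit) mult_pos_pos zero_less_power)
          have "2 * (cmod (F q) * b q) * (t * D q) \<le> (t * D q * cmod (F q))\<^sup>2 + (b q)\<^sup>2"
            using sum_squares_bound[of "t * D q * cmod (F q)" "b q"] by (simp add: algebra_simps)
          also have "\<dots> \<le> (t * D q * cmod (F q))\<^sup>2 + ?K * cube_weight \<gamma> q * D q"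
            using bD[OF q elim(1)] by simp
          also have "\<dots> = (t * (D q * (cmod (F q))\<^sup>2) + ?K / t * cube_weight \<gamma> q) * (t * D q)"
            using t c by (simp add: field_simps power2_eq_square)
          finally show ?case
            using Dpos t by (simp only: mult_le_cancel_right_pos mult_pos_pos)
        qed
      qed (intro Bochner_Integration.integrable_add integrable_mult_right ints integrable_cube_weight gam)+
      also have "\<dots> = t * (m * Re (energy_on eh (disp eh p) A f)) + ?K / t * J"
        by (subst Bochner_Integration.integral_add)
           (auto simp: energy J_def intro!: integrable_mult_right ints integrable_cube_weight gam)
      finally show ?thesis
        by simp
    qed
    from AM_GM_optimise[OF m _ en0 _ this]
    show "m * (cmod (f x))\<^sup>2 \<le> (?K * J) * Re (energy_on eh (disp eh p) A f)"
      using c J by simp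
  qed
  show ?thesis
  \<comment> \<open>Only \<open>J \<ge> 0\<close> is at hand, so 1 is added to make the constant
    positive; this is harmless because the energy is nonnegative.\<close>
  proof (rule that[of "4 / c * J / m + 1"])
    show "4 / c * J / m + 1 > 0"
      using c J m by (simp add: add_nonneg_pos)
    fix A :: "(int^'n) set" and f :: "int^'n \<Rightarrow> complex" and x :: "int^'n"
    assume A: "finite A" "x \<in> A" and f0: "f 0 = 0"
    let ?E = "lat_norm x powr s * Re (energy_on eh (disp eh p) A f)"
    have "(cmod (f x))\<^sup>2 \<le> (4 / c * lat_norm x powr s * J) * Re (energy_on eh (disp eh p) A f) / m"
      using main(1)[of A x f, OF A f0] by (subst pos_le_divide_eq[OF m]) (simp only: mult.commute[of _ m])
    then have "(cmod (f x))\<^sup>2 \<le> 4 / c * J / m * ?E"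
      by (simp add: mult_ac)
    moreover have "?E \<ge> 0"
      using main(2)[of A x f, OF A f0] by simp
    ultimately show "(cmod (f x))\<^sup>2 \<le> (4 / c * J / m + 1) * lat_norm x powr s * Re (energy_on eh (disp eh p) A f)"
      by (simp add: algebra_simps)
  qed
qed

section \<open>Counting dimensions by a trace\<close>

definition csubspace :: "('x \<Rightarrow> complex) set \<Rightarrow> bool" where
  "csubspace V \<longleftrightarrow> (\<lambda>_. 0) \<in> V \<and> (\<forall>u\<in>V. \<forall>w\<in>V. \<forall>a b. (\<lambda>x. a * u x + b * w x) \<in> V)"

definition clinear_on :: "('x \<Rightarrow> complex) set \<Rightarrow> (('x \<Rightarrow> complex) \<Rightarrow> complex) \<Rightarrow> bool" where
  "clinear_on V \<phi> \<longleftrightarrow> (\<forall>u\<in>V. \<forall>w\<in>V. \<forall>a b. \<phi> (\<lambda>x. a * u x + b * w x) = a * \<phi> u + b * \<phi> w)"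

text \<open>Indexed by a set rather than stated for a set of vectors: the vectors are replaced
  repeatedly while the index set keeps the count.\<close>

definition indep_on :: "'i set \<Rightarrow> ('i \<Rightarrow> 'x \<Rightarrow> complex) \<Rightarrow> bool" where
  "indep_on I f \<longleftrightarrow> (\<forall>c. (\<forall>x. (\<Sum>i\<in>I. c i * f i x) = 0) \<longrightarrow> (\<forall>i\<in>I. c i = 0))"

lemma csubspaceD: "csubspace V \<Longrightarrow> u \<in> V \<Longrightarrow> w \<in> V \<Longrightarrow> (\<lambda>x. a * u x + b * w x) \<in> V"
  by (simp add: csubspace_def)

lemma clinear_onD:
  "clinear_on V \<phi> \<Longrightarrow> u \<in> V \<Longrightarrow> w \<in> V \<Longrightarrow> \<phi> (\<lambda>x. a * u x + b * w x) = a * \<phi> u + b * \<phi> w"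
  by (simp add: clinear_on_def)

lemma clinear_on_zero:
  assumes "csubspace V" "clinear_on V \<phi>"
  shows "\<phi> (\<lambda>_. 0) = 0"
  using clinear_onD[OF assms(2), of "\<lambda>_. 0" "\<lambda>_. 0" 0 0] assms(1) by (simp add: csubspace_def)

lemma csubspace_sum:
  assumes V: "csubspace V" and "finite I" "\<And>i. i \<in> I \<Longrightarrow> u i \<in> V"
  shows "(\<lambda>x. \<Sum>i\<in>I. c i * u i x) \<in> V"
  using assms(2,3)
proof (induction I rule: finite_induct)
  case empty
  then show ?case using V by (simp add: csubspace_def)
next
  case (insert i I)
  then show ?case
    using csubspaceD[OF V, of "u i" "\<lambda>x. \<Sum>i\<in>I. c i * u i x" "c i" 1] by simp
qed

lemma clinear_on_sum:
  assumes V: "csubspace V" and \<phi>: "clinear_on V \<phi>" and "finite I" "\<And>i. i \<in> I \<Longrightarrow> u i \<in> V"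
  shows "\<phi> (\<lambda>x. \<Sum>i\<in>I. c i * u i x) = (\<Sum>i\<in>I. c i * \<phi> (u i))"
  using assms(3,4)
proof (induction I rule: finite_induct)
  case empty
  then show ?case using clinear_on_zero[OF V \<phi>] by simp
next
  case (insert i I)
  then show ?case
    using clinear_onD[OF \<phi>, of "u i" "\<lambda>x. \<Sum>i\<in>I. c i * u i x" "c i" 1] csubspace_sum[OF V, of I u c] by simp
qed

lemma csubspace_kernel:
  assumes "csubspace V" "clinear_on V \<phi>"
  shows "csubspace {u \<in> V. \<phi> u = 0}"
  using assms clinear_on_zero[OF assms] by (auto simp: csubspace_def clinear_on_def)

lemma indep_on_nonzero:
  assumes "finite I" "indep_on I f" "i \<in> I"
  shows "f i \<noteq> (\<lambda>_. 0)"
proof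
  assume 0: "f i = (\<lambda>_. 0)"
  have "\<forall>x. (\<Sum>j\<in>I. (if j = i then 1 else 0) * f j x) = 0"
    using 0 by (intro allI sum.neutral) auto
  then have "\<forall>j\<in>I. (if j = i then 1 else 0 :: complex) = 0"
    using assms(2) unfolding indep_on_def by (elim allE[of _ "\<lambda>j. if j = i then 1 else 0"]) blast
  then show False
    using assms(3) by auto
qed

lemma indep_on_subset:
  assumes "finite I" "indep_on I f" "J \<subseteq> I"
  shows "indep_on J f"
  unfolding indep_on_def
proof (intro allI impI)
  fix c assume c: "\<forall>x. (\<Sum>i\<in>J. c i * f i x) = 0"
  have "(\<Sum>i\<in>I. (if i \<in> J then c i else 0) * f i x) = (\<Sum>i\<in>J. c i * f i x)" for x
    using assms(1,3) by (intro sum.mono_neutral_cong_right) auto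
  then have "\<forall>i\<in>I. (if i \<in> J then c i else 0) = 0"
    using assms(2) c unfolding indep_on_def by (elim allE[of _ "\<lambda>i. if i \<in> J then c i else 0"]) simp
  then show "\<forall>i\<in>J. c i = 0"
    using assms(3) by (metis subsetD)
qed

text \<open>One linear condition costs at most one vector: take a pivot with nonzero value and
  subtract multiples of it from the others. It serves both the condition \<open>f 0 = 0\<close> and
  the orthogonalisation.\<close>

lemma indep_on_kernel:
  assumes V: "csubspace V" and \<phi>: "clinear_on V \<phi>"
    and I: "finite I" "I \<noteq> {}" and f: "indep_on I f" "\<And>i. i \<in> I \<Longrightarrow> f i \<in> V"
  obtains k g where "k \<in> I" "indep_on (I - {k}) g" "\<And>i. i \<in> I - {k} \<Longrightarrow> g i \<in> {u \<in> V. \<phi> u = 0}"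
proof (cases "\<forall>i\<in>I. \<phi> (f i) = 0")
  case True
  obtain k where "k \<in> I" using I by blast
  with True show ?thesis
    using indep_on_subset[OF I(1) f(1), of "I - {k}"] f(2) by (intro that[of k f]) auto
next
  case False
  then obtain k where k: "k \<in> I" "\<phi> (f k) \<noteq> 0" by blast
  define r where "r i = - \<phi> (f i) / \<phi> (f k)" for i
  define g where "g i = (\<lambda>x. 1 * f i x + r i * f k x)" for i
  show ?thesis
  proof (rule that[of k g])
    show "indep_on (I - {k}) g"
      unfolding indep_on_def
    proof (intro allI impI)
      fix c assume c: "\<forall>x. (\<Sum>i\<in>I - {k}. c i * g i x) = 0"
      \<comment> \<open>A relation among the \<open>g i\<close> is pulled back to the
        \<open>f i\<close>; the pivot collects all the multiples that were subtracted.\<close>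
      define d where "d i = (if i = k then (\<Sum>j\<in>I - {k}. c j * r j) else c i)" for i
      have "(\<Sum>i\<in>I. d i * f i x) = 0" for x
      proof -
        have "(\<Sum>i\<in>I. d i * f i x) = (\<Sum>j\<in>I - {k}. c j * r j) * f k x + (\<Sum>i\<in>I - {k}. c i * f i x)"
          using I k by (subst sum.remove[of I k]) (auto simp: d_def intro!: sum.cong)
        also have "\<dots> = (\<Sum>i\<in>I - {k}. c i * g i x)"
          by (simp add: g_def sum_distrib_right sum.distrib distrib_left mult.assoc)
        finally show ?thesis using c by simp
      qed
      then have "\<forall>i\<in>I. d i = 0"
        using f(1) unfolding indep_on_def by blast
      then show "\<forall>i\<in>I - {k}. c i = 0"
        by (metis DiffE d_def singletonI)
    qed
    show "g i \<in> {u \<in> V. \<phi> u = 0}" if "i \<in> I - {k}" for i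
      using clinear_onD[OF \<phi>, of "f i" "f k" 1 "r i"] csubspaceD[OF V, of "f i" "f k" 1 "r i"] that f(2) k
      by (simp add: g_def r_def)
  qed (use k in auto)
qed

text \<open>Gram-Schmidt by induction: normalise one vector and continue inside its
  \<open>B\<close>-orthogonal complement in \<open>V\<close>. Only the number of vectors and their
  membership in \<open>V\<close> matter later, so the span of \<open>f\<close> is not
  tracked.\<close>

lemma orthonormal_family:
  fixes B :: "('x \<Rightarrow> complex) \<Rightarrow> ('x \<Rightarrow> complex) \<Rightarrow> complex"
  assumes "finite I" "indep_on I f" "\<And>i. i \<in> I \<Longrightarrow> f i \<in> V" "csubspace V"
    and lin: "\<And>w. w \<in> V \<Longrightarrow> clinear_on V (\<lambda>u. B u w)"
    and herm: "\<And>u w. u \<in> V \<Longrightarrow> w \<in> V \<Longrightarrow> B w u = cnj (B u w)"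
    and pos: "\<And>u. u \<in> V \<Longrightarrow> u \<noteq> (\<lambda>_. 0) \<Longrightarrow> Re (B u u) > 0"
  shows "\<exists>e. (\<forall>i\<in>I. e i \<in> V) \<and> (\<forall>i\<in>I. \<forall>j\<in>I. B (e i) (e j) = (if i = j then 1 else 0))"
  using assms
proof (induction "card I" arbitrary: I f V)
  case 0
  show ?case using 0(1,2) by simp
next
  case (Suc n)
  note V = \<open>csubspace V\<close> and lin = Suc.prems(5) and herm = Suc.prems(6) and pos = Suc.prems(7)
  have "I \<noteq> {}" using Suc.hyps(2) by auto
  then obtain i0 where i0: "i0 \<in> I" by blast
  define u where "u = f i0"
  have u: "u \<in> V" "u \<noteq> (\<lambda>_. 0)"
    using Suc.prems(3)[OF i0] indep_on_nonzero[OF Suc.prems(1,2) i0] by (simp_all add: u_def)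
  define t where "t = sqrt (Re (B u u))"
  have t: "t > 0" "t\<^sup>2 = Re (B u u)"
    using pos[OF u] by (auto simp: t_def)
  have Buu: "B u u = of_real (t\<^sup>2)"
    using herm[OF u(1) u(1)] by (simp add: complex_eq_iff t(2) del: of_real_power)
  define e0 where "e0 = (\<lambda>x. of_real (1 / t) * u x + 0 * u x)"
  have e0: "e0 \<in> V"
    unfolding e0_def by (rule csubspaceD[OF V u(1) u(1)])
  have scale: "B e0 w = of_real (1 / t) * B u w" if "w \<in> V" for w
    using clinear_onD[OF lin[OF that] u(1) u(1), of "of_real (1 / t)" 0] by (simp add: e0_def)
  have "B e0 e0 = of_real (1 / t) * cnj (of_real (1 / t) * B u u)"
    using scale[OF e0] scale[OF u(1)] herm[OF e0 u(1)] by simp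
  then have one: "B e0 e0 = 1"
    using t Buu by (simp add: power2_eq_square)
  let ?\<phi> = "\<lambda>w. B w e0"
  obtain k g where k: "k \<in> I" and g: "indep_on (I - {k}) g" "\<And>i. i \<in> I - {k} \<Longrightarrow> g i \<in> {w \<in> V. ?\<phi> w = 0}"
    using indep_on_kernel[OF V lin[OF e0] Suc.prems(1) _ Suc.prems(2,3)] i0 by blast
  have "\<exists>e. (\<forall>i\<in>I - {k}. e i \<in> {w \<in> V. ?\<phi> w = 0}) \<and>
      (\<forall>i\<in>I - {k}. \<forall>j\<in>I - {k}. B (e i) (e j) = (if i = j then 1 else 0))"
  proof (rule Suc.hyps(1)[OF _ _ g csubspace_kernel[OF V lin[OF e0]]])
    show "n = card (I - {k})"
      using Suc.hyps(2) Suc.prems(1) k by simp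
    show "finite (I - {k})"
      using Suc.prems(1) by simp
    show "clinear_on {w \<in> V. ?\<phi> w = 0} (\<lambda>u. B u w)" if "w \<in> {w \<in> V. ?\<phi> w = 0}" for w
      using lin[of w] that by (auto simp: clinear_on_def)
    show "B w u = cnj (B u w)" if "u \<in> {w \<in> V. ?\<phi> w = 0}" "w \<in> {w \<in> V. ?\<phi> w = 0}" for u w
      using that by (intro herm) blast+
    show "Re (B u u) > 0" if "u \<in> {w \<in> V. ?\<phi> w = 0}" "u \<noteq> (\<lambda>_. 0)" for u
      using that by (intro pos) blast+
  qed
  then obtain e where e: "\<forall>i\<in>I - {k}. e i \<in> {w \<in> V. ?\<phi> w = 0}"
    "\<forall>i\<in>I - {k}. \<forall>j\<in>I - {k}. B (e i) (e j) = (if i = j then 1 else 0)"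
    by blast
  have cross: "B e0 (e j) = 0" "B (e j) e0 = 0" if "j \<in> I - {k}" for j
    using e(1) that herm[of "e j" e0] e0 by auto
  show ?case
  \<comment> \<open>The new unit vector takes the index \<open>k\<close> freed by the kernel step,
    which may differ from \<open>i0\<close>.\<close>
  proof (intro exI[of _ "e(k := e0)"] conjI ballI)
    fix i j assume "i \<in> I" "j \<in> I"
    then show "B ((e(k := e0)) i) ((e(k := e0)) j) = (if i = j then 1 else 0)"
      using e(2) one cross by auto
  qed (use e e0 in auto)
qed

lemma has_sum_finite_sum:
  fixes f :: "'i \<Rightarrow> 'x \<Rightarrow> 'b::topological_comm_monoid_add"
  assumes "finite I" "\<And>i. i \<in> I \<Longrightarrow> (f i has_sum s i) A"
  shows "((\<lambda>x. \<Sum>i\<in>I. f i x) has_sum (\<Sum>i\<in>I. s i)) A"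
  using assms by (induction I rule: finite_induct) (auto intro: has_sum_add)

text \<open>For a \<open>B\<close>-orthonormal family \<open>e\<close>, the function \<open>u = (\<Sum>i. cnj (e i x) * e i)\<close> has
  \<open>u x = B u u = (\<Sum>i. |e i x|\<^sup>2)\<close>, so the pointwise bound at \<open>x\<close> gives \<open>(\<Sum>i. |e i x|\<^sup>2) \<le> K x\<close>.
  Summing the energy inequality over the family is then a trace estimate.\<close>

lemma dimension_bound:
  fixes B :: "('x \<Rightarrow> complex) \<Rightarrow> ('x \<Rightarrow> complex) \<Rightarrow> complex" and w K :: "'x \<Rightarrow> real"
  assumes I: "finite I" "indep_on I f" "\<And>i. i \<in> I \<Longrightarrow> f i \<in> V" and V: "csubspace V"
    and lin: "\<And>u. u \<in> V \<Longrightarrow> clinear_on V (\<lambda>u'. B u' u)"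
    and herm: "\<And>u u'. u \<in> V \<Longrightarrow> u' \<in> V \<Longrightarrow> B u' u = cnj (B u u')"
    and K: "\<And>x. K x \<ge> 0" "\<And>u x. u \<in> V \<Longrightarrow> (cmod (u x))\<^sup>2 \<le> K x * Re (B u u)"
    and w: "\<And>x. w x \<ge> 0" "\<And>u. u \<in> V \<Longrightarrow> Re (B u u) \<le> (\<Sum>\<^sub>\<infinity>x. w x * (cmod (u x))\<^sup>2)"
    and summ: "(\<lambda>x. w x * K x) summable_on UNIV"
  shows "real (card I) \<le> (\<Sum>\<^sub>\<infinity>x. w x * K x)"
proof -
  \<comment> \<open>Definiteness of \<open>B\<close> is a consequence of the pointwise bound: a
    nonzero value \<open>u x\<close> forces the energy to be positive.\<close>
  have pos: "Re (B u u) > 0" if u: "u \<in> V" "u \<noteq> (\<lambda>_. 0)" for u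
  proof -
    obtain x where "u x \<noteq> 0" using u(2) by blast
    then have "0 < K x * Re (B u u)"
      using K(2)[OF u(1), of x] by (smt (verit) norm_eq_zero zero_less_power2)
    then show ?thesis
      using K(1)[of x] by (simp add: zero_less_mult_iff)
  qed
  obtain e where e: "\<And>i. i \<in> I \<Longrightarrow> e i \<in> V"
    "\<And>i j. i \<in> I \<Longrightarrow> j \<in> I \<Longrightarrow> B (e i) (e j) = (if i = j then 1 else 0)"
    using orthonormal_family[OF I V lin herm pos] by blast
  have kernel: "(\<Sum>i\<in>I. (cmod (e i x))\<^sup>2) \<le> K x" for x
  proof -
    define T where "T = (\<Sum>i\<in>I. (cmod (e i x))\<^sup>2)"
    define u where "u = (\<lambda>y. \<Sum>i\<in>I. cnj (e i x) * e i y)"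
    have u: "u \<in> V"
      unfolding u_def by (rule csubspace_sum[OF V I(1) e(1)])
    have ux: "u x = of_real T"
      by (simp add: u_def T_def complex_norm_square mult.commute del: of_real_power)
    have "B (e i) u = e i x" if "i \<in> I" for i
    proof -
      have "B u (e i) = (\<Sum>j\<in>I. cnj (e j x) * B (e j) (e i))"
        unfolding u_def by (rule clinear_on_sum[OF V lin[OF e(1)[OF that]] I(1) e(1)])
      also have "\<dots> = (\<Sum>j\<in>I. if j = i then cnj (e i x) else 0)"
        using e(2) that by (intro sum.cong) auto
      also have "\<dots> = cnj (e i x)"
        using that I(1) by simp
      finally show ?thesis
        using herm[OF u e(1)[OF that]] by simp
    qed
    moreover have "B u u = (\<Sum>i\<in>I. cnj (e i x) * B (e i) u)"
      by (subst u_def) (rule clinear_on_sum[OF V lin[OF u] I(1) e(1)])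
    ultimately have "B u u = of_real T"
      by (simp add: T_def complex_norm_square mult.commute del: of_real_power)
    then have "T\<^sup>2 \<le> K x * T"
      using K(2)[OF u, of x] ux by simp
    moreover have "T \<ge> 0"
      by (simp add: T_def sum_nonneg)
    ultimately show ?thesis
      unfolding T_def[symmetric] using K(1)[of x]
      by (cases "T = 0") (auto simp: power2_eq_square)
  qed
  have le: "w x * (cmod (e i x))\<^sup>2 \<le> w x * K x" if "i \<in> I" for i x
  proof -
    have "(cmod (e i x))\<^sup>2 \<le> (\<Sum>i\<in>I. (cmod (e i x))\<^sup>2)"
      using that I(1) by (intro member_le_sum) auto
    then show ?thesis
      using kernel[of x] w(1)[of x] by (intro mult_left_mono) auto
  qed
  have sums: "(\<lambda>x. w x * (cmod (e i x))\<^sup>2) summable_on UNIV" if "i \<in> I" for i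
    by (rule summable_on_comparison_test[OF summ]) (auto simp: le that w)
  have sums_I: "((\<lambda>x. \<Sum>i\<in>I. w x * (cmod (e i x))\<^sup>2) has_sum (\<Sum>i\<in>I. \<Sum>\<^sub>\<infinity>x. w x * (cmod (e i x))\<^sup>2)) UNIV"
    using I(1) sums by (intro has_sum_finite_sum) auto
  have "real (card I) = (\<Sum>i\<in>I. Re (B (e i) (e i)))"
    by (simp add: e(2))
  also have "\<dots> \<le> (\<Sum>i\<in>I. \<Sum>\<^sub>\<infinity>x. w x * (cmod (e i x))\<^sup>2)"
    by (intro sum_mono w e)
  also have "\<dots> = (\<Sum>\<^sub>\<infinity>x. \<Sum>i\<in>I. w x * (cmod (e i x))\<^sup>2)"
    using sums_I by (rule infsumI[symmetric])
  also have "\<dots> \<le> (\<Sum>\<^sub>\<infinity>x. w x * K x)"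
  proof (rule infsum_mono)
    show "(\<lambda>x. \<Sum>i\<in>I. w x * (cmod (e i x))\<^sup>2) summable_on UNIV"
      using sums_I by (rule has_sum_imp_summable)
    show "(\<Sum>i\<in>I. w x * (cmod (e i x))\<^sup>2) \<le> w x * K x" for x
      using kernel[of x] w(1)[of x] by (simp add: sum_distrib_left[symmetric] mult_left_mono)
  qed fact
  finally show ?thesis .
qed

section \<open>The lattice operator\<close>

lemma l2_mult_summable:
  assumes "l2 f" "l2 g"
  shows "(\<lambda>x. f x * cnj (g x)) summable_on UNIV"
proof -
  have "(\<lambda>x. (cmod (f x))\<^sup>2 + (cmod (g x))\<^sup>2) summable_on UNIV"
    using assms unfolding l2_def by (rule summable_on_add)
  then have "(\<lambda>x. norm (f x * cnj (g x))) summable_on UNIV"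
  proof (rule summable_on_comparison_test)
    show "norm (f x * cnj (g x)) \<le> (cmod (f x))\<^sup>2 + (cmod (g x))\<^sup>2" for x
      using sum_squares_bound[of "cmod (f x)" "cmod (g x)"]
        mult_nonneg_nonneg[OF norm_ge_zero[of "f x"] norm_ge_zero[of "g x"]]
      unfolding norm_mult complex_mod_cnj by linarith
  qed simp
  then show ?thesis by (rule abs_summable_summable)
qed

lemma l2_comb:
  assumes "l2 f" "l2 g"
  shows "l2 (\<lambda>x. a * f x + b * g x)"
proof -
  have "(\<lambda>x. 2 * (cmod a)\<^sup>2 * (cmod (f x))\<^sup>2 + 2 * (cmod b)\<^sup>2 * (cmod (g x))\<^sup>2) summable_on UNIV"
    using assms unfolding l2_def by (intro summable_on_add summable_on_cmult_right)
  then show ?thesis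
    unfolding l2_def
  proof (rule summable_on_comparison_test)
    fix x
    have "(cmod (a * f x + b * g x))\<^sup>2 \<le> (cmod a * cmod (f x) + cmod b * cmod (g x))\<^sup>2"
      using norm_triangle_ineq[of "a * f x" "b * g x"] by (intro power_mono) (auto simp: norm_mult)
    also have "\<dots> \<le> 2 * (cmod a)\<^sup>2 * (cmod (f x))\<^sup>2 + 2 * (cmod b)\<^sup>2 * (cmod (g x))\<^sup>2"
      using sum_squares_bound[of "cmod a * cmod (f x)" "cmod b * cmod (g x)"]
      by (simp add: power2_sum power_mult_distrib)
    finally show "(cmod (a * f x + b * g x))\<^sup>2 \<le> 2 * (cmod a)\<^sup>2 * (cmod (f x))\<^sup>2 + 2 * (cmod b)\<^sup>2 * (cmod (g x))\<^sup>2" .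
  qed simp
qed

lemma l2_zero: "l2 (\<lambda>_. 0)"
  by (simp add: l2_def)

lemma csubspace_l2: "csubspace {f. l2 f}"
  by (simp add: csubspace_def l2_comb l2_zero)

lemma l2_bounded:
  assumes "l2 f"
  obtains M where "\<And>x. cmod (f x) \<le> M"
proof
  fix x
  have "(cmod (f x))\<^sup>2 \<le> (\<Sum>\<^sub>\<infinity>x. (cmod (f x))\<^sup>2)"
    using finite_sum_le_infsum[of "\<lambda>x. (cmod (f x))\<^sup>2" UNIV "{x}"] assms by (simp add: l2_def)
  then show "cmod (f x) \<le> sqrt (\<Sum>\<^sub>\<infinity>x. (cmod (f x))\<^sup>2)"
    by (simp add: real_le_rsqrt)
qed

lemma clinear_on_subset: "clinear_on V \<phi> \<Longrightarrow> W \<subseteq> V \<Longrightarrow> clinear_on W \<phi>"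
  unfolding clinear_on_def by blast

section \<open>Inner product, hopping form and energy on square summable functions\<close>

definition ip :: "(int^'n \<Rightarrow> complex) \<Rightarrow> (int^'n \<Rightarrow> complex) \<Rightarrow> complex" where
  "ip f g = (\<Sum>\<^sub>\<infinity>x. f x * cnj (g x))"

text \<open>This is the pairing of \<open>h0 f\<close> with \<open>g\<close>, as one unordered sum
  over pairs: swapping the pair gives hermitian symmetry, and summing by rows gives the
  operator.\<close>

definition hopping_form :: "(int^'n \<Rightarrow> complex) \<Rightarrow> (int^'n \<Rightarrow> complex) \<Rightarrow> (int^'n \<Rightarrow> complex) \<Rightarrow> complex" where
  "hopping_form eh f g = (\<Sum>\<^sub>\<infinity>(x, z). eh (z - x) * f z * cnj (g x))"

text \<open>The polarised version of the form \<open>B\<close> in the overview.\<close>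

definition energy :: "(int^'n \<Rightarrow> complex) \<Rightarrow> real \<Rightarrow> (int^'n \<Rightarrow> complex) \<Rightarrow> (int^'n \<Rightarrow> complex) \<Rightarrow> complex" where
  "energy eh e f g = of_real e * ip f g - hopping_form eh f g"

lemma ip_has_sum:
  assumes "l2 f" "l2 g"
  shows "((\<lambda>x. f x * cnj (g x)) has_sum ip f g) UNIV"
  unfolding ip_def by (rule has_sum_infsum[OF l2_mult_summable[OF assms]])

lemma summable_on_product_nonneg:
  fixes a :: "'a \<Rightarrow> real" and b :: "'b \<Rightarrow> real"
  assumes "a summable_on UNIV" "b summable_on UNIV" "\<And>x. a x \<ge> 0" "\<And>y. b y \<ge> 0"
  shows "(\<lambda>(x, y). a x * b y) summable_on UNIV"
proof -
  have "(\<lambda>(x, y). a x * b y) summable_on (UNIV \<times> UNIV)"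
  proof (rule summable_on_SigmaI)
    show "((\<lambda>y. case (x, y) of (x, y) \<Rightarrow> a x * b y) has_sum a x * infsum b UNIV) UNIV" for x
      using assms(2) by (auto intro!: has_sum_cmult_right)
    show "(\<lambda>x. a x * infsum b UNIV) summable_on UNIV"
      by (intro summable_on_cmult_left assms)
  qed (use assms in auto)
  then show ?thesis by simp
qed

text \<open>The term is dominated by \<open>|eh (z - x)| * (|f z|^2 + |g x|^2)\<close>; after a
  change of variables each half is a product of two summable functions.\<close>

lemma hopping_form_has_sum:
  assumes l1: "(\<lambda>x. norm (eh x)) summable_on UNIV" and "l2 f" "l2 g"
  shows "((\<lambda>(x, z). eh (z - x) * f z * cnj (g x)) has_sum hopping_form eh f g) UNIV"
proof -
  have "(\<lambda>(x, z). cmod (eh (z - x)) * (cmod (f z))\<^sup>2) summable_on UNIV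
    \<longleftrightarrow> (\<lambda>(y, z). cmod (eh y) * (cmod (f z))\<^sup>2) summable_on UNIV"
    by (rule summable_on_reindex_bij_witness[of _ "\<lambda>(y, z). (z - y, z)" "\<lambda>(x, z). (z - x, z)"]) auto
  then have 1: "(\<lambda>(x, z). cmod (eh (z - x)) * (cmod (f z))\<^sup>2) summable_on UNIV"
    using summable_on_product_nonneg[OF l1, of "\<lambda>z. (cmod (f z))\<^sup>2"] assms(2) by (simp add: l2_def)
  have "(\<lambda>(x, z). cmod (eh (z - x)) * (cmod (g x))\<^sup>2) summable_on UNIV
    \<longleftrightarrow> (\<lambda>(y, x). cmod (eh y) * (cmod (g x))\<^sup>2) summable_on UNIV"
    by (rule summable_on_reindex_bij_witness[of _ "\<lambda>(y, x). (x, y + x)" "\<lambda>(x, z). (z - x, x)"]) auto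
  then have 2: "(\<lambda>(x, z). cmod (eh (z - x)) * (cmod (g x))\<^sup>2) summable_on UNIV"
    using summable_on_product_nonneg[OF l1, of "\<lambda>z. (cmod (g z))\<^sup>2"] assms(3) by (simp add: l2_def)
  have "(\<lambda>u. norm (case u of (x, z) \<Rightarrow> eh (z - x) * f z * cnj (g x))) summable_on UNIV"
  proof (rule summable_on_comparison_test[OF summable_on_add[OF 1 2]])
    fix u :: "(int^'a) \<times> (int^'a)"
    obtain x z where u: "u = (x, z)" by fastforce
    have "cmod (f z) * cmod (g x) \<le> (cmod (f z))\<^sup>2 + (cmod (g x))\<^sup>2"
      using sum_squares_bound[of "cmod (f z)" "cmod (g x)"]
        mult_nonneg_nonneg[OF norm_ge_zero[of "f z"] norm_ge_zero[of "g x"]] by linarith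
    then have "cmod (eh (z - x)) * (cmod (f z) * cmod (g x)) \<le> cmod (eh (z - x)) * ((cmod (f z))\<^sup>2 + (cmod (g x))\<^sup>2)"
      by (rule mult_left_mono) simp
    then show "norm (case u of (x, z) \<Rightarrow> eh (z - x) * f z * cnj (g x))
      \<le> (case u of (x, z) \<Rightarrow> cmod (eh (z - x)) * (cmod (f z))\<^sup>2) + (case u of (x, z) \<Rightarrow> cmod (eh (z - x)) * (cmod (g x))\<^sup>2)"
      by (simp add: u norm_mult algebra_simps)
  qed simp
  then show ?thesis
    unfolding hopping_form_def by (rule has_sum_infsum[OF abs_summable_summable])
qed

lemma clinear_on_ip:
  fixes g :: "int^'n \<Rightarrow> complex"
  assumes "l2 g"
  shows "clinear_on {f. l2 f} (\<lambda>f. ip f g)"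
  unfolding clinear_on_def
proof (intro ballI allI, elim CollectE)
  fix u w :: "int^'n \<Rightarrow> complex" and a b assume *: "l2 u" "l2 w"
  have "((\<lambda>x. a * (u x * cnj (g x)) + b * (w x * cnj (g x))) has_sum a * ip u g + b * ip w g) UNIV"
    by (intro has_sum_add has_sum_cmult_right ip_has_sum assms *)
  then show "ip (\<lambda>x. a * u x + b * w x) g = a * ip u g + b * ip w g"
    unfolding ip_def[of "\<lambda>x. a * u x + b * w x"] by (intro infsumI) (simp add: algebra_simps)
qed

lemma clinear_on_hopping_form:
  fixes g :: "int^'n \<Rightarrow> complex"
  assumes "(\<lambda>x. norm (eh x)) summable_on UNIV" "l2 g"
  shows "clinear_on {f. l2 f} (\<lambda>f. hopping_form eh f g)"
  unfolding clinear_on_def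
proof (intro ballI allI, elim CollectE)
  fix u w :: "int^'n \<Rightarrow> complex" and a b assume *: "l2 u" "l2 w"
  have "((\<lambda>y. a * (case y of (x, z) \<Rightarrow> eh (z - x) * u z * cnj (g x)) + b * (case y of (x, z) \<Rightarrow> eh (z - x) * w z * cnj (g x)))
      has_sum a * hopping_form eh u g + b * hopping_form eh w g) UNIV"
    by (intro has_sum_add has_sum_cmult_right hopping_form_has_sum assms *)
  then show "hopping_form eh (\<lambda>x. a * u x + b * w x) g = a * hopping_form eh u g + b * hopping_form eh w g"
    unfolding hopping_form_def[of _ "\<lambda>x. a * u x + b * w x"]
    by (intro infsumI) (simp add: algebra_simps split_def)
qed

lemma clinear_on_energy:
  assumes "(\<lambda>x. norm (eh x)) summable_on UNIV" "l2 g"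
  shows "clinear_on {f. l2 f} (\<lambda>f. energy eh e f g)"
  using clinear_on_ip[OF assms(2)] clinear_on_hopping_form[OF assms]
  by (simp add: clinear_on_def energy_def algebra_simps)

lemma ip_cnj: "ip g f = cnj (ip f g)"
  unfolding ip_def infsum_cnj[symmetric] by (simp add: mult.commute)

lemma hopping_form_cnj:
  assumes sym: "\<And>x. cnj (eh (- x)) = eh x"
  shows "hopping_form eh g f = cnj (hopping_form eh f g)"
proof -
  have "cnj (eh (z - x)) = eh (x - z)" for x z
    using sym[of "x - z"] by simp
  then show ?thesis
    unfolding hopping_form_def infsum_cnj[symmetric]
    by (intro infsum_reindex_bij_witness[of _ prod.swap prod.swap]) auto
qed

lemma energy_cnj:
  assumes "\<And>x. cnj (eh (- x)) = eh x"
  shows "energy eh e g f = cnj (energy eh e f g)"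
  by (simp add: energy_def ip_cnj[of g f] hopping_form_cnj[of eh g f, OF assms])

text \<open>Squares \<open>A \<times> A\<close> are cofinal among the finite sets of pairs, so the
  unordered double sum may be computed along them.\<close>

lemma energy_on_tendsto:
  assumes "(\<lambda>x. norm (eh x)) summable_on UNIV" "l2 f"
  shows "((\<lambda>A. energy_on eh e A f) \<longlongrightarrow> energy eh e f f) (finite_subsets_at_top UNIV)"
proof -
  have sq: "filterlim (\<lambda>A :: (int^'a) set. A \<times> A) (finite_subsets_at_top UNIV) (finite_subsets_at_top UNIV)"
    unfolding filterlim_iff
  proof (intro allI impI)
    fix P :: "((int^'a) \<times> (int^'a)) set \<Rightarrow> bool"
    assume "eventually P (finite_subsets_at_top UNIV)"
    then obtain X where X: "finite X" "\<And>Y. finite Y \<Longrightarrow> X \<subseteq> Y \<Longrightarrow> P Y"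
      by (auto simp: eventually_finite_subsets_at_top)
    show "eventually (\<lambda>A. P (A \<times> A)) (finite_subsets_at_top UNIV)"
      unfolding eventually_finite_subsets_at_top
    proof (intro exI[of _ "fst ` X \<union> snd ` X"] conjI allI impI)
      fix Y assume Y: "finite Y \<and> fst ` X \<union> snd ` X \<subseteq> Y \<and> Y \<subseteq> UNIV"
      then have "X \<subseteq> Y \<times> Y" by force
      then show "P (Y \<times> Y)" using X(2) Y by simp
    qed (use X in auto)
  qed
  have "((\<lambda>A. \<Sum>(x, z)\<in>A \<times> A. eh (z - x) * f z * cnj (f x)) \<longlongrightarrow> hopping_form eh f f) (finite_subsets_at_top UNIV)"
    using filterlim_compose[OF hopping_form_has_sum[OF assms(1,2,2), unfolded has_sum_def] sq] .
  then show ?thesis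
    unfolding energy_on_def energy_def
    by (intro tendsto_intros ip_has_sum[OF assms(2,2), unfolded has_sum_def])
qed

text \<open>Limit of the truncated bounds; the finite sets containing \<open>x\<close> are cofinal,
  so a bound on those is enough.\<close>

lemma l2_point_bound:
  assumes l1: "(\<lambda>x. norm (eh x)) summable_on UNIV" and "l2 f"
    and fin: "\<And>A. finite A \<Longrightarrow> x \<in> A \<Longrightarrow> (cmod (f x))\<^sup>2 \<le> K * Re (energy_on eh e A f)"
  shows "(cmod (f x))\<^sup>2 \<le> K * Re (energy eh e f f)"
proof (rule tendsto_lowerbound)
  show "((\<lambda>A. K * Re (energy_on eh e A f)) \<longlongrightarrow> K * Re (energy eh e f f)) (finite_subsets_at_top UNIV)"
    by (intro tendsto_intros energy_on_tendsto l1 \<open>l2 f\<close>)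
  show "eventually (\<lambda>A. (cmod (f x))\<^sup>2 \<le> K * Re (energy_on eh e A f)) (finite_subsets_at_top UNIV)"
    unfolding eventually_finite_subsets_at_top using fin by (intro exI[of _ "{x}"]) auto
qed simp

lemma hopping_summable:
  assumes l1: "(\<lambda>x. norm (eh x)) summable_on UNIV" and "l2 f"
  shows "(\<lambda>y. eh y * f (x + y)) summable_on UNIV"
proof -
  obtain M where M: "\<And>x. cmod (f x) \<le> M"
    using l2_bounded[OF \<open>l2 f\<close>] by blast
  have "(\<lambda>y. norm (eh y * f (x + y))) summable_on UNIV"
    by (rule summable_on_comparison_test[OF summable_on_cmult_left[OF l1, of M]])
       (auto simp: norm_mult intro!: mult_left_mono M)
  then show ?thesis by (rule abs_summable_summable)
qed

lemma clinear_on_hop: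
  fixes eh :: "int^'n \<Rightarrow> complex"
  assumes l1: "(\<lambda>x. norm (eh x)) summable_on UNIV"
  shows "clinear_on {f. l2 f} (\<lambda>f. hop eh v \<mu> f x)"
  unfolding clinear_on_def
proof (intro ballI allI, elim CollectE)
  fix u w :: "int^'n \<Rightarrow> complex" and a b assume *: "l2 u" "l2 w"
  have "((\<lambda>y. a * (eh y * u (x + y)) + b * (eh y * w (x + y))) has_sum
      a * (\<Sum>\<^sub>\<infinity>y. eh y * u (x + y)) + b * (\<Sum>\<^sub>\<infinity>y. eh y * w (x + y))) UNIV"
    by (intro has_sum_add has_sum_cmult_right has_sum_infsum hopping_summable l1 *)
  then have "(\<Sum>\<^sub>\<infinity>y. eh y * (a * u (x + y) + b * w (x + y)))
    = a * (\<Sum>\<^sub>\<infinity>y. eh y * u (x + y)) + b * (\<Sum>\<^sub>\<infinity>y. eh y * w (x + y))"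
    by (intro infsumI) (simp add: algebra_simps)
  then show "hop eh v \<mu> (\<lambda>x. a * u x + b * w x) x = a * hop eh v \<mu> u x + b * hop eh v \<mu> w x"
    by (simp add: hop_def algebra_simps)
qed

text \<open>The potential term is the difference between the full operator and its hopping part. Its
  convergence is thus a conclusion, inherited from the sums for \<open>ip h g\<close> and
  \<open>hopping_form eh f g\<close>.\<close>

lemma potential_has_sum:
  assumes l1: "(\<lambda>x. norm (eh x)) summable_on UNIV" and l2: "l2 f" "l2 g" "l2 h"
    and h: "\<And>x. hop eh v \<mu> f x = h x"
  shows "((\<lambda>x. of_real (\<mu> * v x) * f x * cnj (g x)) has_sum ip h g - hopping_form eh f g) UNIV"
proof -
  have row: "((\<lambda>z. eh (z - x) * f z * cnj (g x)) has_sum (\<Sum>\<^sub>\<infinity>y. eh y * f (x + y)) * cnj (g x)) UNIV" for x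
  proof -
    have "((\<lambda>y. eh y * f (x + y)) has_sum (\<Sum>\<^sub>\<infinity>y. eh y * f (x + y))) UNIV"
      by (intro has_sum_infsum hopping_summable l1 l2)
    also have "?this \<longleftrightarrow> ((\<lambda>z. eh (z - x) * f z) has_sum (\<Sum>\<^sub>\<infinity>y. eh y * f (x + y))) UNIV"
      by (rule has_sum_reindex_bij_witness[of _ "\<lambda>z. z - x" "\<lambda>y. x + y"]) auto
    finally show ?thesis by (rule has_sum_cmult_left)
  qed
  have "((\<lambda>x. (\<Sum>\<^sub>\<infinity>y. eh y * f (x + y)) * cnj (g x)) has_sum hopping_form eh f g) UNIV"
  proof (rule has_sum_SigmaD)
    show "((\<lambda>(x, z). eh (z - x) * f z * cnj (g x)) has_sum hopping_form eh f g) (UNIV \<times> UNIV)"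
      using hopping_form_has_sum[OF l1 l2(1,2)] by simp
    show "((\<lambda>z. case (x, z) of (x, z) \<Rightarrow> eh (z - x) * f z * cnj (g x)) has_sum
        (\<Sum>\<^sub>\<infinity>y. eh y * f (x + y)) * cnj (g x)) UNIV" for x
      unfolding prod.case by (rule row)
  qed
  from has_sum_add[OF ip_has_sum[OF l2(3,2)] has_sum_uminusI[OF this]]
  have "((\<lambda>x. h x * cnj (g x) + - ((\<Sum>\<^sub>\<infinity>y. eh y * f (x + y)) * cnj (g x))) has_sum ip h g - hopping_form eh f g) UNIV"
    by simp
  then show ?thesis
    by (rule has_sum_cong[THEN iffD1, rotated]) (simp add: h[symmetric] hop_def algebra_simps)
qed

section \<open>Eigenspaces and their finite sums\<close>

definition eigenspace :: "(int^'n \<Rightarrow> complex) \<Rightarrow> (int^'n \<Rightarrow> real) \<Rightarrow> real \<Rightarrow> real \<Rightarrow> (int^'n \<Rightarrow> complex) set" where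
  "eigenspace eh v \<mu> E = {f. l2 f \<and> (\<forall>x. hop eh v \<mu> f x = of_real E * f x)}"

lemma csubspace_eigenspace:
  assumes "(\<lambda>x. norm (eh x)) summable_on UNIV"
  shows "csubspace (eigenspace eh v \<mu> E)"
  unfolding csubspace_def
proof (intro conjI ballI allI)
  show "(\<lambda>_. 0) \<in> eigenspace eh v \<mu> E"
    by (simp add: eigenspace_def l2_zero hop_def)
  fix u w a b assume "u \<in> eigenspace eh v \<mu> E" "w \<in> eigenspace eh v \<mu> E"
  then show "(\<lambda>x. a * u x + b * w x) \<in> eigenspace eh v \<mu> E"
    using clinear_onD[OF clinear_on_hop[OF assms, of v \<mu>], of u w a b]
    by (simp add: eigenspace_def l2_comb algebra_simps)
qed

text \<open>The usual symmetry argument: the potential sum is evaluated once through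
  \<open>E\<close> and once, after conjugation, through \<open>E'\<close>. The hopping forms agree,
  leaving \<open>E * ip F G = E' * ip F G\<close>.\<close>

lemma eigenspace_orthogonal:
  assumes l1: "(\<lambda>x. norm (eh x)) summable_on UNIV" and sym: "\<And>x. cnj (eh (- x)) = eh x"
    and F: "F \<in> eigenspace eh v \<mu> E" and G: "G \<in> eigenspace eh v \<mu> E'" and "E \<noteq> E'"
  shows "ip F G = 0"
proof -
  have l2: "l2 F" "l2 G" using F G by (auto simp: eigenspace_def)
  have scale: "ip (\<lambda>x. of_real c * f x) g = of_real c * ip f g" if "l2 f" "l2 g" for c f and g :: "int^'a \<Rightarrow> complex"
    using clinear_onD[OF clinear_on_ip[OF that(2)], of f f "of_real c" 0] that by simp
  have l2s: "l2 (\<lambda>x. of_real c * f x)" if "l2 f" for c and f :: "int^'a \<Rightarrow> complex"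
    using l2_comb[OF that that, of "of_real c" 0] by simp
  have 1: "((\<lambda>x. of_real (\<mu> * v x) * F x * cnj (G x)) has_sum of_real E * ip F G - hopping_form eh F G) UNIV"
    using potential_has_sum[OF l1 l2(1,2) l2s[OF l2(1)], of v \<mu> E] F l2 by (simp add: eigenspace_def scale)
  have "((\<lambda>x. of_real (\<mu> * v x) * G x * cnj (F x)) has_sum of_real E' * ip G F - hopping_form eh G F) UNIV"
    using potential_has_sum[OF l1 l2(2,1) l2s[OF l2(2)], of v \<mu> E'] G l2 by (simp add: eigenspace_def scale)
  then have "((\<lambda>x. cnj (of_real (\<mu> * v x) * G x * cnj (F x))) has_sum cnj (of_real E' * ip G F - hopping_form eh G F)) UNIV"
    by (simp only: has_sum_cnj_iff)
  then have "((\<lambda>x. of_real (\<mu> * v x) * F x * cnj (G x)) has_sum of_real E' * ip F G - hopping_form eh F G) UNIV"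
    using ip_cnj[of F G] hopping_form_cnj[of eh F G, OF sym] by (simp add: mult_ac)
  from has_sum_unique[OF 1 this] show ?thesis
    using \<open>E \<noteq> E'\<close> by simp
qed

text \<open>Stands in for a spectral subspace. Components are indexed by energy, so distinct ones
  are orthogonal and each carries its own eigenvalue.\<close>

definition spectral_sum :: "(int^'n \<Rightarrow> complex) \<Rightarrow> (int^'n \<Rightarrow> real) \<Rightarrow> real \<Rightarrow> real set \<Rightarrow> (int^'n \<Rightarrow> complex) set" where
  "spectral_sum eh v \<mu> Es =
     {f. \<exists>F. (\<forall>E\<in>Es. F E \<in> eigenspace eh v \<mu> E) \<and> f = (\<lambda>x. \<Sum>E\<in>Es. F E x)}"

lemma csubspace_spectral_sum:
  assumes l1: "(\<lambda>x. norm (eh x)) summable_on UNIV"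
  shows "csubspace (spectral_sum eh v \<mu> Es)"
  unfolding csubspace_def
proof (intro conjI ballI allI)
  show "(\<lambda>_. 0) \<in> spectral_sum eh v \<mu> Es"
    unfolding spectral_sum_def using csubspace_eigenspace[OF l1]
    by (auto simp: csubspace_def intro!: exI[of _ "\<lambda>_ _. 0"])
  fix u w a b assume "u \<in> spectral_sum eh v \<mu> Es" "w \<in> spectral_sum eh v \<mu> Es"
  then obtain F G where F: "\<forall>E\<in>Es. F E \<in> eigenspace eh v \<mu> E" "u = (\<lambda>x. \<Sum>E\<in>Es. F E x)"
    and G: "\<forall>E\<in>Es. G E \<in> eigenspace eh v \<mu> E" "w = (\<lambda>x. \<Sum>E\<in>Es. G E x)"
    unfolding spectral_sum_def by blast
  have "\<forall>E\<in>Es. (\<lambda>x. a * F E x + b * G E x) \<in> eigenspace eh v \<mu> E"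
    using F G csubspaceD[OF csubspace_eigenspace[OF l1]] by blast
  moreover have "(\<lambda>x. a * u x + b * w x) = (\<lambda>x. \<Sum>E\<in>Es. a * F E x + b * G E x)"
    by (simp add: F G sum.distrib sum_distrib_left)
  ultimately show "(\<lambda>x. a * u x + b * w x) \<in> spectral_sum eh v \<mu> Es"
    unfolding spectral_sum_def by (auto intro!: exI[of _ "\<lambda>E x. a * F E x + b * G E x"])
qed

lemma spectral_sum_l2:
  assumes "finite Es" "f \<in> spectral_sum eh v \<mu> Es"
  shows "l2 f"
proof -
  obtain F where F: "\<forall>E\<in>Es. F E \<in> eigenspace eh v \<mu> E" "f = (\<lambda>x. \<Sum>E\<in>Es. F E x)"
    using assms unfolding spectral_sum_def by blast
  then show ?thesis
    using csubspace_sum[OF csubspace_l2 assms(1), of F "\<lambda>_. 1"] by (simp add: eigenspace_def)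
qed

lemma eigenspace_subset_spectral_sum:
  assumes l1: "(\<lambda>x. norm (eh x)) summable_on UNIV"
    and "finite Es" "E \<in> Es" "f \<in> eigenspace eh v \<mu> E"
  shows "f \<in> spectral_sum eh v \<mu> Es"
  unfolding spectral_sum_def
  using assms csubspace_eigenspace[OF l1]
  by (auto simp: csubspace_def intro!: exI[of _ "\<lambda>E'. if E' = E then f else (\<lambda>_. 0)"] simp: if_distribR cong: if_cong)

text \<open>By orthogonality, pairing the full operator applied to \<open>f\<close> with
  \<open>f\<close> gives the sum of \<open>E * |F E|^2\<close>, which is at least
  \<open>e * |f|^2\<close>. Subtracting the hopping form from both leaves the potential alone on the
  larger side.\<close>

lemma energy_le_potential:
  fixes eh :: "int^'n \<Rightarrow> complex"
  assumes l1: "(\<lambda>x. norm (eh x)) summable_on UNIV" and sym: "\<And>x. cnj (eh (- x)) = eh x"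
    and Es: "finite Es" "\<And>E. E \<in> Es \<Longrightarrow> e \<le> E" and f: "f \<in> spectral_sum eh v \<mu> Es" and \<mu>: "\<mu> \<ge> 0"
  shows "Re (energy eh e f f) \<le> (\<Sum>\<^sub>\<infinity>x. \<mu> * \<bar>v x\<bar> * (cmod (f x))\<^sup>2)"
proof -
  obtain F where F: "\<And>E. E \<in> Es \<Longrightarrow> F E \<in> eigenspace eh v \<mu> E" "f = (\<lambda>x. \<Sum>E\<in>Es. F E x)"
    using f unfolding spectral_sum_def by blast
  have l2F: "l2 (F E)" if "E \<in> Es" for E
    using F(1)[OF that] by (simp add: eigenspace_def)
  have "l2 f" by (rule spectral_sum_l2[OF Es(1) f])
  \<comment> \<open>The full operator applied to \<open>f\<close>, computed componentwise; this also
    shows that the image is square summable.\<close>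
  define h where "h = (\<lambda>x. \<Sum>E\<in>Es. of_real E * F E x)"
  have "l2 h"
    using csubspace_sum[OF csubspace_l2 Es(1), of F of_real] l2F by (simp add: h_def)
  have "hop eh v \<mu> f x = h x" for x
    using clinear_on_sum[OF csubspace_l2 clinear_on_hop[OF l1, of v \<mu> x] Es(1), of F "\<lambda>_. 1"] l2F F
    by (simp add: h_def eigenspace_def)
  from potential_has_sum[OF l1 \<open>l2 f\<close> \<open>l2 f\<close> \<open>l2 h\<close> this]
  have "((\<lambda>x. of_real (\<mu> * v x) * f x * cnj (f x)) has_sum ip h f - hopping_form eh f f) UNIV" .
  from has_sum_Re[OF this]
  have pot: "((\<lambda>x. \<mu> * v x * (cmod (f x))\<^sup>2) has_sum Re (ip h f - hopping_form eh f f)) UNIV"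
    by (simp add: mult.assoc complex_mult_cnj cmod_power2)
  have ipF: "ip (F E) f = ip (F E) (F E)" if E: "E \<in> Es" for E
  proof -
    have "ip f (F E) = (\<Sum>E'\<in>Es. 1 * ip (F E') (F E))"
      using clinear_on_sum[OF csubspace_l2 clinear_on_ip[OF l2F[OF E]] Es(1), of F "\<lambda>_. 1"] l2F
      by (simp add: F(2))
    also have "\<dots> = (\<Sum>E'\<in>Es. if E' = E then ip (F E) (F E) else 0)"
      using eigenspace_orthogonal[of eh, OF l1 sym F(1) F(1)] E by (intro sum.cong) auto
    also have "\<dots> = ip (F E) (F E)"
      using E Es(1) by simp
    finally show ?thesis
      using ip_cnj[of "F E" f] ip_cnj[of "F E" "F E"] by simp
  qed
  have "Re (ip h f) - e * Re (ip f f) = (\<Sum>E\<in>Es. (E - e) * Re (ip (F E) (F E)))"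
  proof -
    have "ip h f = (\<Sum>E\<in>Es. of_real E * ip (F E) f)"
      using clinear_on_sum[OF csubspace_l2 clinear_on_ip[OF \<open>l2 f\<close>] Es(1), of F of_real] l2F
      by (simp add: h_def)
    moreover have "ip f f = (\<Sum>E\<in>Es. 1 * ip (F E) f)"
      using clinear_on_sum[OF csubspace_l2 clinear_on_ip[OF \<open>l2 f\<close>] Es(1), of F "\<lambda>_. 1"] l2F
      by (simp add: F(2)[symmetric])
    ultimately show ?thesis
      by (simp add: ipF sum_distrib_left sum_subtractf algebra_simps)
  qed
  also have "\<dots> \<ge> 0"
  proof (intro sum_nonneg mult_nonneg_nonneg)
    fix E assume E: "E \<in> Es"
    show "0 \<le> E - e" using Es(2)[OF E] by simp
    show "0 \<le> Re (ip (F E) (F E))"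
      using has_sum_Re[OF ip_has_sum[OF l2F[OF E] l2F[OF E]]]
      by (rule has_sum_nonneg) (simp add: complex_mult_cnj)
  qed
  finally have "Re (energy eh e f f) \<le> Re (ip h f - hopping_form eh f f)"
    by (simp add: energy_def)
  also have "\<dots> = (\<Sum>\<^sub>\<infinity>x. \<mu> * v x * (cmod (f x))\<^sup>2)"
    using infsumI[OF pot] by simp
  also have "\<dots> \<le> (\<Sum>\<^sub>\<infinity>x. \<mu> * \<bar>v x\<bar> * (cmod (f x))\<^sup>2)"
  proof (rule infsum_mono)
    show "(\<lambda>x. \<mu> * v x * (cmod (f x))\<^sup>2) summable_on UNIV"
      using pot by (rule has_sum_imp_summable)
    \<comment> \<open>For real families summability is absolute, so passing to
      \<open>\<bar>v x\<bar>\<close> keeps the sum convergent.\<close>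
    then have "(\<lambda>x. norm (\<mu> * v x * (cmod (f x))\<^sup>2)) summable_on UNIV"
      by (simp only: summable_on_iff_abs_summable_on_real[symmetric])
    then show "(\<lambda>x. \<mu> * \<bar>v x\<bar> * (cmod (f x))\<^sup>2) summable_on UNIV"
      using \<mu> by (simp add: abs_mult)
    show "\<mu> * v x * (cmod (f x))\<^sup>2 \<le> \<mu> * \<bar>v x\<bar> * (cmod (f x))\<^sup>2" for x
      using \<mu> by (intro mult_right_mono mult_left_mono) auto
  qed
  finally show ?thesis .
qed

text \<open>\<open>C\<close> is fixed before \<open>v\<close> and \<open>\<mu>\<close>, so it
  depends only on the dispersion relation and \<open>\<gamma>\<close>.\<close>

lemma Nplus_bound:
  fixes eh :: "int^'n \<Rightarrow> complex" and \<gamma> :: real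
  assumes dim: "CARD('n) \<le> 2"
    and l1: "(\<lambda>x. norm (eh x)) summable_on UNIV"
    and sym: "\<And>x. cnj (eh (- x)) = eh x"
    and maxpt: "p1 \<in> torus" "\<And>p. p \<in> torus \<Longrightarrow> p \<noteq> p1 \<Longrightarrow> disp eh p < disp eh p1"
    and C2max: "C2_nondeg_at (disp eh) p1"
    and gam: "0 < \<gamma>" "\<gamma> < 1"
  defines "s \<equiv> 2 - real CARD('n) + \<gamma>"
  obtains C where "C > 0" "\<And>(v :: int^'n \<Rightarrow> real) \<mu>.
    (\<lambda>x. lat_norm x powr s * \<bar>v x\<bar>) summable_on UNIV \<Longrightarrow> \<mu> > 0 \<Longrightarrow>
      ereal_of_enat (Nplus eh v \<mu> (disp eh p1)) \<le> ereal (1 + C * \<mu> * (\<Sum>\<^sub>\<infinity>x. lat_norm x powr s * \<bar>v x\<bar>))"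
proof -
  obtain c where c: "c > 0" "\<And>q. q \<in> pi_cube \<Longrightarrow> c * (norm q)\<^sup>2 \<le> disp eh p1 - disp eh (p1 + q)"
    using disp_quadratic_bound[OF l1 maxpt C2max] by blast
  obtain C where C: "C > 0"
    "\<And>A f x. finite A \<Longrightarrow> x \<in> A \<Longrightarrow> f 0 = 0 \<Longrightarrow>
       (cmod (f x))\<^sup>2 \<le> C * lat_norm x powr s * Re (energy_on eh (disp eh p1) A f)"
    using finite_support_bound[of eh, OF dim l1 sym c gam] unfolding s_def by blast
  let ?e = "disp eh p1"
  have main: "ereal_of_enat (Nplus eh v \<mu> ?e) \<le> ereal (1 + C * \<mu> * (\<Sum>\<^sub>\<infinity>x. lat_norm x powr s * \<bar>v x\<bar>))"
    if v: "(\<lambda>x. lat_norm x powr s * \<bar>v x\<bar>) summable_on UNIV" and \<mu>: "\<mu> > 0" for v :: "int^'n \<Rightarrow> real" and \<mu>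
  proof -
    define R where "R = C * \<mu> * (\<Sum>\<^sub>\<infinity>x. lat_norm x powr s * \<bar>v x\<bar>)"
    have wK: "(\<mu> * \<bar>v x\<bar>) * (C * lat_norm x powr s) = C * \<mu> * (lat_norm x powr s * \<bar>v x\<bar>)" for x
      by (simp add: mult_ac)
    have R: "R = (\<Sum>\<^sub>\<infinity>x. (\<mu> * \<bar>v x\<bar>) * (C * lat_norm x powr s))"
      unfolding R_def wK by (simp add: infsum_cmult_right')
    have R0: "R \<ge> 0"
      unfolding R using C \<mu> by (intro infsum_nonneg) auto
    have card: "real (card S) \<le> 1 + R"
      if S: "finite S" "lin_indep S" "\<forall>f\<in>S. \<exists>E\<in>{?e<..}. is_eigvec eh v \<mu> E f" for S
    proof (cases "S = {}")
      case True
      then show ?thesis using R0 by simp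
    next
      case False
      obtain ev where ev: "\<And>f. f \<in> S \<Longrightarrow> ev f > ?e \<and> is_eigvec eh v \<mu> (ev f) f"
        using S(3) by (metis greaterThan_iff)
      \<comment> \<open>One eigenvalue is chosen per vector of the family, which gives a finite set
        without any knowledge of the discreteness of the spectrum.\<close>
      define Es where "Es = ev ` S"
      have Es: "finite Es" "\<And>E. E \<in> Es \<Longrightarrow> ?e \<le> E"
        using S ev by (auto simp: Es_def intro: less_imp_le)
      let ?V = "spectral_sum eh v \<mu> Es"
      have SV: "f \<in> ?V" if "f \<in> S" for f
        using ev[OF that] that
        by (intro eigenspace_subset_spectral_sum[OF l1 Es(1), of "ev f"]) (auto simp: Es_def eigenspace_def is_eigvec_def)
      have V: "csubspace ?V" by (rule csubspace_spectral_sum[OF l1])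
      have ind: "indep_on S (\<lambda>f. f)"
        using S(2) by (simp add: lin_indep_def indep_on_def)
      \<comment> \<open>Evaluation at the origin is the one functional whose kernel is imposed; it
        accounts for the \<open>1\<close> in the estimate.\<close>
      have lin0: "clinear_on ?V (\<lambda>u. u 0)"
        by (simp add: clinear_on_def)
      obtain k g where k: "k \<in> S" "indep_on (S - {k}) g" "\<And>i. i \<in> S - {k} \<Longrightarrow> g i \<in> {u \<in> ?V. u 0 = 0}"
        using indep_on_kernel[OF V lin0 S(1) False ind] SV by blast
      have "real (card (S - {k})) \<le> (\<Sum>\<^sub>\<infinity>x. (\<mu> * \<bar>v x\<bar>) * (C * lat_norm x powr s))"
      proof (rule dimension_bound[where B = "energy eh ?e", OF _ k(2,3) csubspace_kernel[OF V lin0]])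
        show "finite (S - {k})" using S by simp
        show "clinear_on {u \<in> ?V. u 0 = 0} (\<lambda>u'. energy eh ?e u' u)" if "u \<in> {u \<in> ?V. u 0 = 0}" for u
          by (rule clinear_on_subset[OF clinear_on_energy[OF l1]]) (use that spectral_sum_l2[OF Es(1)] in blast)+
        show "energy eh ?e u' u = cnj (energy eh ?e u u')" for u u'
          by (rule energy_cnj[of eh, OF sym])
        show "C * lat_norm x powr s \<ge> 0" for x
          using C by simp
        show "(cmod (u x))\<^sup>2 \<le> C * lat_norm x powr s * Re (energy eh ?e u u)" if "u \<in> {u \<in> ?V. u 0 = 0}" for u x
          using that spectral_sum_l2[OF Es(1), of u] C(2) by (intro l2_point_bound[OF l1]) auto
        show "\<mu> * \<bar>v x\<bar> \<ge> 0" for x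
          using \<mu> by simp
        show "Re (energy eh ?e u u) \<le> (\<Sum>\<^sub>\<infinity>x. \<mu> * \<bar>v x\<bar> * (cmod (u x))\<^sup>2)" if "u \<in> {u \<in> ?V. u 0 = 0}" for u
          using that \<mu> by (intro energy_le_potential[of eh, OF l1 sym Es]) auto
        show "(\<lambda>x. \<mu> * \<bar>v x\<bar> * (C * lat_norm x powr s)) summable_on UNIV"
          unfolding wK by (intro summable_on_cmult_right v)
      qed
      then have "real (card (S - {k})) \<le> R"
        by (simp add: R)
      moreover have "card S = Suc (card (S - {k}))"
        using S(1) k(1) by (rule card.remove)
      ultimately show ?thesis by simp
    qed
    \<comment> \<open>Cardinalities are integers, so the real bound may be rounded down; a natural
      number bounding every family then bounds the supremum in \<open>enat\<close>.\<close>
    have "Nplus eh v \<mu> ?e \<le> enat (nat \<lfloor>1 + R\<rfloor>)"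
      unfolding Nplus_def eig_count_def
    proof (rule SUP_least)
      fix S assume "S \<in> {S. finite S \<and> lin_indep S \<and> (\<forall>f\<in>S. \<exists>E\<in>{?e<..}. is_eigvec eh v \<mu> E f)}"
      then have "real (card S) \<le> 1 + R"
        by (intro card) auto
      then have "card S \<le> nat \<lfloor>1 + R\<rfloor>"
        by (rule le_nat_floor)
      then show "enat (card S) \<le> enat (nat \<lfloor>1 + R\<rfloor>)"
        by (simp only: enat_ord_simps)
    qed
    then have "ereal_of_enat (Nplus eh v \<mu> ?e) \<le> ereal_of_enat (enat (nat \<lfloor>1 + R\<rfloor>))"
      by (simp only: ereal_of_enat_le_iff)
    also have "\<dots> \<le> ereal (1 + R)"
      using R0 by simp
    finally show ?thesis
      unfolding R_def .
  qed
  show ?thesis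
    by (rule that[OF C(1) main])
qed

section \<open>Reflection to the lower edge, and the theorem\<close>

lemma is_eigvec_uminus:
  "is_eigvec (\<lambda>x. - eh x) (\<lambda>x. - v x) \<mu> (- E) f \<longleftrightarrow> is_eigvec eh v \<mu> E f"
proof -
  have "hop (\<lambda>x. - eh x) (\<lambda>x. - v x) \<mu> f x = - hop eh v \<mu> f x" for x
    by (simp add: hop_def infsum_uminus)
  then show ?thesis
    by (simp add: is_eigvec_def)
qed

lemma Nminus_eq_Nplus: "Nminus eh v \<mu> t = Nplus (\<lambda>x. - eh x) (\<lambda>x. - v x) \<mu> (- t)"
proof -
  have "(\<exists>E\<in>{..<t}. is_eigvec eh v \<mu> E f) \<longleftrightarrow> (\<exists>E\<in>{-t<..}. is_eigvec (\<lambda>x. - eh x) (\<lambda>x. - v x) \<mu> E f)" for f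
    using is_eigvec_uminus[of eh v \<mu> _ f]
    by (metis add.inverse_inverse greaterThan_iff lessThan_iff neg_less_iff_less)
  then show ?thesis
    by (simp add: Nminus_def Nplus_def eig_count_def)
qed

lemma disp_uminus: "disp (\<lambda>x. - eh x) p = - disp eh p"
  by (simp add: disp_def infsum_uminus)

lemma C2_nondeg_at_uminus:
  assumes "C2_nondeg_at f p"
  shows "C2_nondeg_at (\<lambda>q. - f q) p"
proof -
  obtain U g H where U: "open U" "p \<in> U"
    and f': "\<And>q. q \<in> U \<Longrightarrow> (f has_derivative (\<lambda>h. g q \<bullet> h)) (at q)"
    and g': "\<And>q. q \<in> U \<Longrightarrow> (g has_derivative (\<lambda>h. H q *v h)) (at q)"
    and H: "continuous_on U H" "invertible (H p)"
    using assms unfolding C2_nondeg_at_def by blast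
  obtain B where B: "H p ** B = mat 1" "B ** H p = mat 1"
    using H(2) unfolding invertible_def by blast
  have "(- H p) ** (- B) = mat 1" "(- B) ** (- H p) = mat 1"
    using B by (simp_all add: matrix_matrix_mult_def vec_eq_iff)
  then have "invertible (- H p)"
    unfolding invertible_def by blast
  moreover have "((\<lambda>q. - f q) has_derivative (\<lambda>h. (- g q) \<bullet> h)) (at q)" if "q \<in> U" for q
    using has_derivative_minus[OF f'[OF that]] by simp
  moreover have "((\<lambda>q. - g q) has_derivative (\<lambda>h. (- H q) *v h)) (at q)" if "q \<in> U" for q
  proof -
    have "(- H q) *v h = - (H q *v h)" for h
      by (simp add: matrix_vector_mult_def vec_eq_iff sum_negf)
    then show ?thesis
      using has_derivative_minus[OF g'[OF that]] by simp
  qed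
  moreover have "continuous_on U (\<lambda>q. - H q)"
    by (intro continuous_intros H)
  ultimately show ?thesis
    unfolding C2_nondeg_at_def using U
    by (intro exI[of _ U] exI[of _ "\<lambda>q. - g q"] exI[of _ "\<lambda>q. - H q"]) blast
qed

theorem theorem1p1:
  fixes eh :: "int^'n \<Rightarrow> complex" and \<gamma> :: real
  assumes dim: "CARD('n) = 1 \<or> CARD('n) = 2"
    and l1: "(\<lambda>x. norm (eh x)) summable_on UNIV"
    and sym: "\<And>x. cnj (eh (- x)) = eh x"
    and minpt: "p0 \<in> torus" "\<And>p. p \<in> torus \<Longrightarrow> p \<noteq> p0 \<Longrightarrow> disp eh p0 < disp eh p"
    and maxpt: "p1 \<in> torus" "\<And>p. p \<in> torus \<Longrightarrow> p \<noteq> p1 \<Longrightarrow> disp eh p < disp eh p1"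
    and C2min: "C2_nondeg_at (disp eh) p0"
    and C2max: "C2_nondeg_at (disp eh) p1"
    and gam: "0 < \<gamma>" "\<gamma> < 1"
  shows "\<exists>C1 C2. C1 > 0 \<and> C2 > 0 \<and>
    (\<forall>(v :: int^'n \<Rightarrow> real) \<mu>.
       (\<lambda>x. lat_norm x powr (2 - real CARD('n) + \<gamma>) * \<bar>v x\<bar>) summable_on UNIV \<longrightarrow>
       0 < (\<Sum>\<^sub>\<infinity>x. lat_norm x powr (2 - real CARD('n) + \<gamma>) * \<bar>v x\<bar>) \<longrightarrow>
       \<mu> > 0 \<longrightarrow>
       ereal_of_enat (Nplus eh v \<mu> (disp eh p1)) \<le>
          ereal (1 + C1 * \<mu> * (\<Sum>\<^sub>\<infinity>x. lat_norm x powr (2 - real CARD('n) + \<gamma>) * \<bar>v x\<bar>)) \<and>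
       ereal_of_enat (Nminus eh v \<mu> (disp eh p0)) \<le>
          ereal (1 + C2 * \<mu> * (\<Sum>\<^sub>\<infinity>x. lat_norm x powr (2 - real CARD('n) + \<gamma>) * \<bar>v x\<bar>)) \<and>
       Nplus eh v \<mu> (disp eh p1) + Nminus eh v \<mu> (disp eh p0) < \<infinity>)"
proof -
  let ?s = "2 - real CARD('n) + \<gamma>"
  have dim2: "CARD('n) \<le> 2" using dim by auto
  obtain C1 where C1: "C1 > 0" "\<And>(v :: int^'n \<Rightarrow> real) \<mu>.
    (\<lambda>x. lat_norm x powr ?s * \<bar>v x\<bar>) summable_on UNIV \<Longrightarrow> \<mu> > 0 \<Longrightarrow>
      ereal_of_enat (Nplus eh v \<mu> (disp eh p1)) \<le> ereal (1 + C1 * \<mu> * (\<Sum>\<^sub>\<infinity>x. lat_norm x powr ?s * \<bar>v x\<bar>))"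
    using Nplus_bound[of eh, OF dim2 l1 sym maxpt C2max gam] by blast
  have l1': "(\<lambda>x. norm (- eh x)) summable_on UNIV" using l1 by simp
  have sym': "cnj (- eh (- x)) = - eh x" for x using sym[of x] by simp
  have min': "disp (\<lambda>x. - eh x) p < disp (\<lambda>x. - eh x) p0" if "p \<in> torus" "p \<noteq> p0" for p
    using minpt(2)[OF that] by (simp add: disp_uminus)
  have C2': "C2_nondeg_at (disp (\<lambda>x. - eh x)) p0"
    using C2_nondeg_at_uminus[OF C2min] by (simp add: disp_uminus[abs_def])
  obtain C2 where C2: "C2 > 0" "\<And>(v :: int^'n \<Rightarrow> real) \<mu>.
    (\<lambda>x. lat_norm x powr ?s * \<bar>v x\<bar>) summable_on UNIV \<Longrightarrow> \<mu> > 0 \<Longrightarrow>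
      ereal_of_enat (Nplus (\<lambda>x. - eh x) v \<mu> (disp (\<lambda>x. - eh x) p0))
        \<le> ereal (1 + C2 * \<mu> * (\<Sum>\<^sub>\<infinity>x. lat_norm x powr ?s * \<bar>v x\<bar>))"
    using Nplus_bound[of "\<lambda>x. - eh x", OF dim2 l1' sym' minpt(1) min' C2' gam] by blast
  have fin: "n < \<infinity>" if "ereal_of_enat n \<le> ereal r" for n r
    using that by (cases n) auto
  show ?thesis
  proof (rule exI[of _ C1], rule exI[of _ C2], intro conjI allI impI)
    fix v :: "int^'n \<Rightarrow> real" and \<mu> :: real
    assume v: "(\<lambda>x. lat_norm x powr ?s * \<bar>v x\<bar>) summable_on UNIV" and \<mu>: "\<mu> > 0"
    show plus: "ereal_of_enat (Nplus eh v \<mu> (disp eh p1)) \<le> ereal (1 + C1 * \<mu> * (\<Sum>\<^sub>\<infinity>x. lat_norm x powr ?s * \<bar>v x\<bar>))"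
      by (rule C1(2)[OF v \<mu>])
    show minus: "ereal_of_enat (Nminus eh v \<mu> (disp eh p0)) \<le> ereal (1 + C2 * \<mu> * (\<Sum>\<^sub>\<infinity>x. lat_norm x powr ?s * \<bar>v x\<bar>))"
      \<comment> \<open>The bound sees only \<open>\<bar>v x\<bar>\<close>, so the sign change of
        the potential leaves its right-hand side as it was.\<close>
      using C2(2)[of "\<lambda>x. - v x" \<mu>] v \<mu> by (simp add: Nminus_eq_Nplus disp_uminus)
    show "Nplus eh v \<mu> (disp eh p1) + Nminus eh v \<mu> (disp eh p0) < \<infinity>"
      using fin[OF plus] fin[OF minus] by (simp add: plus_eq_infty_iff_enat less_top[symmetric])
  qed (use C1 C2 in auto)
qed

end
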